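(* Let $K$ be a field, $n\ge 1$, let $\widehat{X}=(x_{ij})$ be the generic $(n+1)\times n$ matrix and $Y=(y_1,\dots,y_n)^T$ the generic $n\times 1$ matrix, and let $\widehat{R}=K[x_{ij},y_j\mid 1\le i\le n+1,\ 1\le j\le n]$. Let $g_i=\sum_{j=1}^{n}x_{ij}y_j$ for $1\le i\le n+1$ and $\mathcal{J}=I_1(\widehat{X}Y)=\langle g_1,\dots,g_{n+1}\rangle$. The total Betti numbers of $\mathcal{J}$ are $$\beta_0=1,\qquad \beta_1=n+1,\qquad \beta_{n+1}=n,\qquad \beta_{k+1}=\binom{n}{k}+\binom{n}{k-1}+\binom{n}{k+1}\quad\text{for }1\le k<n.$$
   Context: All $x_{ij},y_j$ are independent indeterminates over $K$, and $\widehat{R}$ has the standard grading. The total Betti numbers $\beta_i$ of the ideal $\mathcal{J}$ are the ranks of the free modules in the minimal graded free resolution of $\widehat{R}/\mathcal{J}$ over $\widehat{R}$, with $\beta_0$ the rank of the free module in homological degree $0$. *)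

theory Defs
  imports
    "HOL-Library.Poly_Mapping"
    "HOL-Library.Cardinality"
    "Jordan_Normal_Form.Matrix_Kernel"
begin

type_synonym ('v, 'k) mpoly = "('v \<Rightarrow>\<^sub>0 nat) \<Rightarrow>\<^sub>0 'k"

definition indet :: "'v \<Rightarrow> ('v, 'k::field) mpoly" where
  "indet v = Poly_Mapping.single (Poly_Mapping.single v 1) 1"

definition monom_degree :: "('v \<Rightarrow>\<^sub>0 nat) \<Rightarrow> nat" where
  "monom_degree t = (\<Sum>v\<in>Poly_Mapping.keys t. Poly_Mapping.lookup t v)"

text \<open>Membership in the component of degree \<open>e\<close> of the standard grading; zero lies in every
  component, and components of negative degree are zero.\<close>

definition homogeneous :: "int \<Rightarrow> ('v, 'k::field) mpoly \<Rightarrow> bool" where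
  "homogeneous e p \<longleftrightarrow> (\<forall>t\<in>Poly_Mapping.keys p. int (monom_degree t) = e)"

text \<open>An ideal is a submodule of the ring regarded as a module over itself.\<close>

definition ideal_of :: "'r::comm_ring_1 set \<Rightarrow> 'r set" where
  "ideal_of = Modules.module.span (*)"

definition irrelevant_ideal :: "('v, 'k::field) mpoly set" where
  "irrelevant_ideal = ideal_of (indet ` UNIV)"

text \<open>Let \<open>R\<close> be the polynomial ring and \<open>J\<close> an ideal.  The data \<open>b\<close>, \<open>s\<close>, \<open>\<epsilon>\<close>, \<open>D\<close>
  describe a sequence of finitely generated graded free modules and degree-preserving maps
    \<open>\<dots> \<longrightarrow> F 2 \<longrightarrow> F 1 \<longrightarrow> F 0 \<longrightarrow> R/J \<longrightarrow> 0\<close>.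
  Here \<open>F i\<close> is \<open>R^(b i)\<close> with its \<open>c\<close>-th basis vector in degree \<open>s i c\<close>, that is, the direct
  sum of the twists \<open>R(-s i c)\<close>; the matrix \<open>D i\<close> is the map from \<open>F (i + 1)\<close> to \<open>F i\<close>.
  A graded map from \<open>F 0\<close> to \<open>R/J\<close> is given by the images of the basis vectors, and the
  vector \<open>\<epsilon>\<close> lists homogeneous representatives of these: \<open>v\<close> goes to the class of \<open>\<epsilon> \<bullet> v\<close>.\<close>

definition graded_free_resolution ::
  "('v, 'k::field) mpoly set \<Rightarrow> (nat \<Rightarrow> nat) \<Rightarrow> (nat \<Rightarrow> nat \<Rightarrow> int) \<Rightarrow>
   ('v, 'k) mpoly vec \<Rightarrow> (nat \<Rightarrow> ('v, 'k) mpoly mat) \<Rightarrow> bool" where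
  "graded_free_resolution J b s \<epsilon> D \<longleftrightarrow>
     \<epsilon> \<in> carrier_vec (b 0) \<and>
     (\<forall>c<b 0. homogeneous (s 0 c) (\<epsilon> $ c)) \<and>
     (\<forall>i. D i \<in> carrier_mat (b i) (b (Suc i))) \<and>
     (\<forall>i. \<forall>r<b i. \<forall>c<b (Suc i). homogeneous (s (Suc i) c - s i r) (D i $$ (r, c))) \<and>
     (\<forall>a. \<exists>v\<in>carrier_vec (b 0). a - \<epsilon> \<bullet> v \<in> J) \<and>
     {v \<in> carrier_vec (b 0). \<epsilon> \<bullet> v \<in> J} = (\<lambda>w. D 0 *\<^sub>v w) ` carrier_vec (b 1) \<and>
     (\<forall>i. mat_kernel (D i) = (\<lambda>w. D (Suc i) *\<^sub>v w) ` carrier_vec (b (Suc (Suc i))))"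

text \<open>Minimality: the image of \<open>F (i + 1)\<close> lies in the product of the irrelevant ideal with
  \<open>F i\<close>, which consists of the vectors with all coordinates in the irrelevant ideal.\<close>

definition minimal_graded_free_resolution ::
  "('v, 'k::field) mpoly set \<Rightarrow> (nat \<Rightarrow> nat) \<Rightarrow> (nat \<Rightarrow> nat \<Rightarrow> int) \<Rightarrow>
   ('v, 'k) mpoly vec \<Rightarrow> (nat \<Rightarrow> ('v, 'k) mpoly mat) \<Rightarrow> bool" where
  "minimal_graded_free_resolution J b s \<epsilon> D \<longleftrightarrow>
     graded_free_resolution J b s \<epsilon> D \<and>
     (\<forall>i. \<forall>w\<in>carrier_vec (b (Suc i)). \<forall>r<b i. (D i *\<^sub>v w) $ r \<in> irrelevant_ideal)"

text \<open>With \<open>THE\<close>, a value of a Betti number can only be proved by showing that a minimal graded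
  free resolution of \<open>R/J\<close> exists and that all of them have the same ranks.\<close>

definition total_betti :: "('v, 'k::field) mpoly set \<Rightarrow> nat \<Rightarrow> nat" where
  "total_betti J i = (THE r. \<exists>b s \<epsilon> D. minimal_graded_free_resolution J b s \<epsilon> D \<and> r = b i)"

text \<open>The indeterminates: the entries of a generic matrix with rows indexed by \<open>'m\<close> and columns
  indexed by \<open>'n\<close>, and those of a generic column indexed by \<open>'n\<close>.\<close>

datatype ('m, 'n) var = X 'm 'n | Y 'n

definition g :: "'m \<Rightarrow> (('m, 'n::finite) var, 'k::field) mpoly" where
  "g i = (\<Sum>j\<in>UNIV. indet (X i j) * indet (Y j))"

definition ideal_J :: "(('m, 'n::finite) var, 'k::field) mpoly set" where
  "ideal_J = ideal_of (g ` UNIV)"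

end

theory Submission
  imports Defs
begin

text \<open>
Let \<open>R\<close> be the polynomial ring, \<open>g\<^sub>1, \<dots>, g\<^sub>n\<close> the forms of all rows but one, \<open>g'\<close> the form
of the remaining row, \<open>I = (g\<^sub>1, \<dots>, g\<^sub>n)\<close>, \<open>(y)\<close> the ideal of the entries of the column and
\<open>\<Delta>\<close> the determinant of the chosen \<open>n\<close> rows. The theorem rests on \<open>I : \<Delta> = (y)\<close> and
\<open>I : g' = I + (\<Delta>)\<close>, that is, on the two exact sequences \<open>0 \<rightarrow> R/(y) \<rightarrow> R/I \<rightarrow> R/(I + (\<Delta>)) \<rightarrow> 0\<close>
and \<open>0 \<rightarrow> R/(I + (\<Delta>)) \<rightarrow> R/I \<rightarrow> R/J \<rightarrow> 0\<close>, whose first maps are multiplication by \<open>\<Delta>\<close> and by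
\<open>g'\<close>. Both \<open>g\<^sub>1, \<dots>, g\<^sub>n\<close> and \<open>y\<close> are regular sequences, so \<open>R/I\<close> and \<open>R/(y)\<close> have Koszul
resolutions with ranks \<open>n choose i\<close>, and two mapping cones give a resolution of \<open>R/J\<close>. The
first cone has ranks \<open>(n + 1) choose i\<close> and contains one nonzero constant, in the top degree
of the comparison map; cancelling it changes the rank \<open>n + 1\<close> in degree \<open>n\<close> to \<open>n\<close> and the
rank \<open>1\<close> in degree \<open>n + 1\<close> to \<open>0\<close>. The second cone is minimal for degree reasons. Adding
\<open>n choose i\<close> to the ranks of the former complex in degree \<open>i - 1\<close> gives the Betti numbers.

The statements about ideals (\<open>regular_row_forms\<close>, \<open>colon_row_form\<close>, \<open>colon_minor\<close>) are
proved by induction on the number of columns. For the first two, setting one \<open>y\<close> to zero deletes a column,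
relations of the smaller matrix are lifted back (\<open>lift_relation\<close>), and the step from an
entry of the column to a form with fresh coefficients is a comparison of leading
coefficients (\<open>leading_coefficient_colon\<close>).

On the homological side, chain maps and homotopies (\<open>chain_map_extension\<close>, \<open>null_homotopy\<close>)
give the cones (\<open>cone_resolution\<close>), the constant entry (\<open>minor_ideal_resolution\<close>), and the
independence of the ranks from the minimal resolution (\<open>minimal_rank_le\<close>), without which the
Betti numbers would not be determined.
\<close>

section \<open>Ideals\<close>

lemma module_ring: "Modules.module ((*) :: 'a::comm_ring_1 \<Rightarrow> 'a \<Rightarrow> 'a)"
  by unfold_locales (simp_all add: algebra_simps)

lemmas ideal_base = Modules.module.span_base[OF module_ring, folded ideal_of_def]
  and ideal_zero = Modules.module.span_zero[OF module_ring, folded ideal_of_def]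
  and ideal_add = Modules.module.span_add[OF module_ring, folded ideal_of_def]
  and ideal_diff = Modules.module.span_diff[OF module_ring, folded ideal_of_def]
  and ideal_uminus = Modules.module.span_neg[OF module_ring, folded ideal_of_def]
  and ideal_mult = Modules.module.span_scale[OF module_ring, folded ideal_of_def]
  and ideal_sum = Modules.module.span_sum[OF module_ring, folded ideal_of_def]
  and ideal_mono = Modules.module.span_mono[OF module_ring, folded ideal_of_def]
  and ideal_insert_iff = Modules.module.span_breakdown_eq[OF module_ring, folded ideal_of_def]
  and ideal_induct = Modules.module.span_induct_alt[OF module_ring, folded ideal_of_def, consumes 1, case_names base step]

lemma ideal_empty: "ideal_of {} = {0 :: 'a::comm_ring_1}"
  using Modules.module.span_empty[OF module_ring] by (simp add: ideal_of_def)

lemma ideal_mult_right: "x \<in> ideal_of S \<Longrightarrow> x * c \<in> ideal_of S"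
  using ideal_mult[of x S c] by (simp add: mult.commute)

lemma ideal_subset:
  assumes "\<And>s. s \<in> S \<Longrightarrow> s \<in> ideal_of T" "p \<in> ideal_of S"
  shows "p \<in> ideal_of T"
  using assms(2)
proof (induct rule: ideal_induct)
  case base show ?case by (rule ideal_zero)
next
  case (step c x y)
  then show ?case using assms(1) by (simp add: ideal_add ideal_mult)
qed

lemma ideal_add_iff:
  assumes "x - y \<in> ideal_of S"
  shows "x \<in> ideal_of S \<longleftrightarrow> y \<in> ideal_of S"
  using ideal_diff[OF _ assms, of x] ideal_add[OF assms, of y] by auto

text \<open>Coefficients indexed by positions in a list, rather than by the generators, let relations
be handled by recursion on the list, with the coefficient of the head at index \<open>0\<close>.\<close>

lemma ideal_index_combination:
  assumes "p \<in> ideal_of (set L)"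
  shows "\<exists>a. p = (\<Sum>i<length L. a i * L ! i)"
  using assms
proof (induct L arbitrary: p)
  case Nil
  then show ?case by (simp add: ideal_empty)
next
  case (Cons x L)
  then obtain k where k: "p - k * x \<in> ideal_of (set L)" by (auto simp: ideal_insert_iff)
  from Cons(1)[OF this] obtain a where a: "p - k * x = (\<Sum>i<length L. a i * L ! i)" ..
  have "p = (\<Sum>i<length (x # L). (case i of 0 \<Rightarrow> k | Suc j \<Rightarrow> a j) * (x # L) ! i)"
    using a by (simp add: sum.lessThan_Suc_shift algebra_simps del: sum.lessThan_Suc)
  then show ?case by blast
qed

section \<open>Division by an indeterminate\<close>

lemma single_decomposition:
  "p = (\<Sum>t\<in>Poly_Mapping.keys p. Poly_Mapping.single t (Poly_Mapping.lookup p t))"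
  by (rule poly_mapping_eqI)
     (simp add: lookup_sum lookup_single when_def in_keys_iff sum.delta' if_distrib cong: if_cong)

lemma single_induct [case_names zero single add]:
  fixes p :: "'a \<Rightarrow>\<^sub>0 'b::comm_monoid_add"
  assumes "P 0" "\<And>t c. P (Poly_Mapping.single t c)" "\<And>p q. P p \<Longrightarrow> P q \<Longrightarrow> P (p + q)"
  shows "P p"
proof -
  have "P (\<Sum>t\<in>A. Poly_Mapping.single t (Poly_Mapping.lookup p t))" if "finite A" for A
    using that by induct (auto intro: assms)
  from this[of "Poly_Mapping.keys p"] show ?thesis by (simp add: single_decomposition[symmetric])
qed

text \<open>The quotient of \<open>p\<close> on division by the indeterminate \<open>v\<close>; the remainder is
\<open>indet_free_part v p\<close> below. In particular \<open>indet_quot v p = 0\<close> says that \<open>v\<close> does not occur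
in \<open>p\<close>.\<close>

definition indet_quot :: "'v \<Rightarrow> ('v, 'k::field) mpoly \<Rightarrow> ('v, 'k) mpoly" where
  "indet_quot v p = Poly_Mapping.map_key (\<lambda>t. t + Poly_Mapping.single v 1) p"

lemma lookup_indet_quot:
  "Poly_Mapping.lookup (indet_quot v p) t = Poly_Mapping.lookup p (t + Poly_Mapping.single v 1)"
  unfolding indet_quot_def by (subst map_key.rep_eq) (auto simp: inj_def)

lemma indet_quot_add: "indet_quot v (p + q) = indet_quot v p + indet_quot v q"
  and indet_quot_diff: "indet_quot v (p - q) = indet_quot v p - indet_quot v q"
  and indet_quot_0: "indet_quot v 0 = 0"
  by (rule poly_mapping_eqI, simp add: lookup_indet_quot lookup_add lookup_minus)+

lemma indet_quot_sum: "indet_quot v (sum f A) = (\<Sum>x\<in>A. indet_quot v (f x))"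
  by (induct A rule: infinite_finite_induct) (auto simp: indet_quot_add indet_quot_0)

lemma monomial_minus_plus:
  assumes "Poly_Mapping.lookup t v \<noteq> (0::nat)"
  shows "t - Poly_Mapping.single v 1 + Poly_Mapping.single v 1 = t"
  by (rule poly_mapping_eqI) (use assms in \<open>auto simp: lookup_add lookup_minus lookup_single when_def\<close>)

lemma indet_quot_single:
  "indet_quot v (Poly_Mapping.single t c) =
    (if Poly_Mapping.lookup t v = 0 then 0 else Poly_Mapping.single (t - Poly_Mapping.single v 1) c)"
proof (cases "Poly_Mapping.lookup t v = 0")
  case True
  then have "t \<noteq> s + Poly_Mapping.single v 1" for s
    by (metis add_eq_0_iff_both_eq_0 lookup_add lookup_single_eq one_neq_zero)
  then show ?thesis
    using True by (auto intro!: poly_mapping_eqI simp: lookup_indet_quot lookup_single when_def)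
next
  case False
  then show ?thesis
    by (auto intro!: poly_mapping_eqI simp: lookup_indet_quot lookup_single when_def monomial_minus_plus)
       (metis False One_nat_def monomial_minus_plus)
qed

lemma indet_mult_single:
  "indet v * Poly_Mapping.single t c = Poly_Mapping.single (t + Poly_Mapping.single v 1) c"
  by (simp add: indet_def mult_single add.commute)

lemma indet_quot_indet_mult: "indet_quot v (indet v * p) = p"
proof (induct p rule: single_induct)
  case (single t c)
  then show ?case
    unfolding indet_mult_single by (simp add: indet_quot_single lookup_add)
qed (auto simp: indet_quot_0 distrib_left indet_quot_add)

lemma single_mult_indet_quot_free:
  assumes "Poly_Mapping.lookup t v = 0"
  shows "indet_quot v (Poly_Mapping.single t c * q) = Poly_Mapping.single t c * indet_quot v q"
proof (induct q rule: single_induct)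
  case (single s d)
  show ?case
  proof (cases "Poly_Mapping.lookup s v = 0")
    case True
    then show ?thesis using assms by (simp add: mult_single indet_quot_single lookup_add)
  next
    case False
    then have "t + s - Poly_Mapping.single v 1 = t + (s - Poly_Mapping.single v 1)"
      by (auto intro!: poly_mapping_eqI simp: lookup_add lookup_minus lookup_single when_def)
    then show ?thesis using assms False by (simp add: mult_single indet_quot_single lookup_add)
  qed
qed (auto simp: indet_quot_0 distrib_left indet_quot_add)

text \<open>The substitution \<open>v := 0\<close>.\<close>

definition indet_free_part :: "'v \<Rightarrow> ('v, 'k::field) mpoly \<Rightarrow> ('v, 'k) mpoly" where
  "indet_free_part v p = p - indet v * indet_quot v p"

lemma indet_free_part_decomposition: "p = indet_free_part v p + indet v * indet_quot v p"
  by (simp add: indet_free_part_def)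

text \<open>Substitute \<open>p = p\<^sub>0 + v p\<^sub>1\<close> in \<open>p q\<close>, where \<open>p\<^sub>0\<close> is free of \<open>v\<close>, and divide by \<open>v\<close>. The
substitution \<open>v := 0\<close> is a ring homomorphism because of this rule.\<close>

lemma indet_quot_mult: "indet_quot v (p * q) = indet_quot v p * q + indet_free_part v p * indet_quot v q"
proof (induct p rule: single_induct)
  case (single t c)
  show ?case
  proof (cases "Poly_Mapping.lookup t v = 0")
    case True
    then show ?thesis using single_mult_indet_quot_free[OF True] by (simp add: indet_free_part_def indet_quot_single)
  next
    case False
    define p where "p = Poly_Mapping.single (t - Poly_Mapping.single v 1) c"
    have *: "Poly_Mapping.single t c = indet v * p"
      unfolding p_def indet_mult_single monomial_minus_plus[OF False] ..
    show ?thesis unfolding * by (simp add: indet_free_part_def indet_quot_indet_mult mult.assoc)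
  qed
qed (auto simp: indet_quot_0 indet_free_part_def indet_quot_add algebra_simps)

lemma indet_free_part_mult: "indet_free_part v (p * q) = indet_free_part v p * indet_free_part v q"
  by (simp add: indet_free_part_def indet_quot_mult algebra_simps)

lemma indet_free_part_add: "indet_free_part v (p + q) = indet_free_part v p + indet_free_part v q"
  by (simp add: indet_free_part_def indet_quot_add algebra_simps)

lemma indet_free_part_sum: "indet_free_part v (sum f A) = (\<Sum>x\<in>A. indet_free_part v (f x))"
  by (induct A rule: infinite_finite_induct) (auto simp: indet_free_part_add, simp_all add: indet_free_part_def indet_quot_0)

lemma indet_quot_mult_free: "indet_quot v q = 0 \<Longrightarrow> indet_quot v (p * q) = indet_quot v p * q"
  by (simp add: indet_quot_mult)

lemma indet_quot_1: "indet_quot v 1 = 0"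
  using indet_quot_single[of v 0 1] by simp

lemma indet_quot_indet: "indet_quot v (indet w) = (if v = w then 1 else 0)"
  unfolding indet_def by (simp add: indet_quot_single lookup_single)

lemma indet_free_part_indet: "indet_free_part v (indet w) = (if v = w then 0 else indet w)"
  by (simp add: indet_free_part_def indet_quot_indet)

lemma indet_cancel: "indet v * p = indet v * q \<Longrightarrow> p = q"
  by (metis indet_quot_indet_mult)

lemma indet_quot_free_mult: "indet_quot v p = 0 \<Longrightarrow> indet_quot v q = 0 \<Longrightarrow> indet_quot v (p * q) = 0"
  by (simp add: indet_quot_mult)

lemma indet_quot_free_sum: "(\<And>x. x \<in> A \<Longrightarrow> indet_quot v (f x) = 0) \<Longrightarrow> indet_quot v (sum f A) = 0"
  by (simp add: indet_quot_sum)

lemma indet_quot_free_prod: "(\<And>x. x \<in> A \<Longrightarrow> indet_quot v (f x) = 0) \<Longrightarrow> indet_quot v (prod f A) = 0"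
  by (induct A rule: infinite_finite_induct) (auto simp: indet_quot_1 indet_quot_free_mult)

lemma indet_quot_free_of_int: "indet_quot v (of_int k) = 0"
proof -
  have "indet_quot v (of_nat n) = 0" for n by (induct n) (auto simp: indet_quot_0 indet_quot_add indet_quot_1)
  moreover have "indet_quot v (- of_nat n) = 0" for n using indet_quot_diff[of v 0 "of_nat n"]
    by (simp add: calculation indet_quot_0)
  ultimately show ?thesis by (cases k rule: int_cases2) auto
qed

text \<open>Every polynomial has finite degree in \<open>v\<close>.\<close>

lemma indet_quot_nilpotent:
  fixes p :: "('a, 'b::field) mpoly"
  shows "\<exists>D. (indet_quot v ^^ D) p = 0"
proof -
  have pow_0: "(indet_quot v ^^ D) (0::('a, 'b) mpoly) = 0" for D
    by (induct D) (auto simp: indet_quot_0)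
  have pow_add: "(indet_quot v ^^ D) (p + q) = (indet_quot v ^^ D) p + (indet_quot v ^^ D) q"
    for D and p q :: "('a, 'b) mpoly"
    by (induct D) (auto simp: indet_quot_add)
  show ?thesis
  proof (induct p rule: single_induct)
    case zero
    show ?case by (rule exI[of _ 0]) simp
  next
    case (single t c)
    have "(indet_quot v ^^ Suc k) (Poly_Mapping.single t c) = 0" if "Poly_Mapping.lookup t v \<le> k" for k
      using that
    proof (induct k arbitrary: t)
      case 0
      then show ?case by (simp add: indet_quot_single)
    next
      case (Suc k)
      show ?case
      proof (cases "Poly_Mapping.lookup t v = 0")
        case True
        then show ?thesis
          unfolding funpow_Suc_right[of "Suc k"] o_apply indet_quot_single using True by (simp add: pow_0 del: funpow.simps)
      next
        case False
        have "(indet_quot v ^^ Suc k) (Poly_Mapping.single (t - Poly_Mapping.single v 1) c) = 0"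
          using Suc(2) by (intro Suc(1)) (simp add: lookup_minus)
        then show ?thesis
          unfolding funpow_Suc_right[of "Suc k"] o_apply indet_quot_single using False by (simp del: funpow.simps)
      qed
    qed
    then show ?case by blast
  next
    case (add p q)
    then obtain D E where "(indet_quot v ^^ D) p = 0" "(indet_quot v ^^ E) q = 0" by blast
    then have "(indet_quot v ^^ (E + D)) p = 0" "(indet_quot v ^^ (D + E)) q = 0"
      using pow_0 by (simp_all add: funpow_add)
    then have "(indet_quot v ^^ (D + E)) (p + q) = 0"
      by (simp add: pow_add add.commute)
    then show ?case by blast
  qed
qed

section \<open>Colon ideals from leading coefficients\<close>

lemma ideal_indet_quot_closed:
  assumes "\<And>s. s \<in> S \<Longrightarrow> indet_quot v s = 0" "p \<in> ideal_of S"
  shows "indet_quot v p \<in> ideal_of S"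
  using assms(2)
proof (induct rule: ideal_induct)
  case base show ?case by (simp add: indet_quot_0 ideal_zero)
next
  case (step c x y)
  then show ?case using assms(1)
    by (simp add: indet_quot_add indet_quot_mult_free ideal_add ideal_mult ideal_base)
qed

text \<open>A variant of McCoy's theorem on zero divisors in polynomial rings. If \<open>v\<close> does not occur in
the generators of \<open>I\<close>, then \<open>I\<close> contains with \<open>f (v y + r)\<close> also its leading coefficient in
\<open>v\<close>, which is \<open>c y\<close> for the leading coefficient \<open>c\<close> of \<open>f\<close>. Hence \<open>c\<close> lies in \<open>Q\<close>, the
leading term of \<open>f\<close> can be split off because \<open>Q (v y + r) \<subseteq> I\<close>, and the degree of \<open>f\<close> in \<open>v\<close>
drops. Thus the colon ideal of \<open>v y + r\<close> is controlled by that of the simpler element \<open>y\<close>.\<close>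

lemma leading_coefficient_colon:
  assumes S: "\<And>s. s \<in> S \<Longrightarrow> indet_quot v s = 0"
    and free: "indet_quot v y = 0" "indet_quot v r = 0"
    and y: "\<And>f. f * y \<in> ideal_of S \<Longrightarrow> f \<in> ideal_of T"
    and T: "\<And>t. t \<in> T \<Longrightarrow> t * (indet v * y + r) \<in> ideal_of S"
    and f: "f * (indet v * y + r) \<in> ideal_of S"
  shows "f \<in> ideal_of T"
proof -
  let ?q = "indet v * y + r"
  have T': "t * ?q \<in> ideal_of S" if "t \<in> ideal_of T" for t
    using that
  proof (induct rule: ideal_induct)
    case base show ?case by (simp add: ideal_zero)
  next
    case (step c x y)
    then show ?case using ideal_add[OF ideal_mult[OF T[OF step(1)], of c]]
      by (simp add: distrib_right mult.assoc)
  qed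
  have pow_ideal: "(indet_quot v ^^ D) p \<in> ideal_of S" if "p \<in> ideal_of S" for D p
    using that by (induct D) (auto intro: ideal_indet_quot_closed[OF S])
  have pow_mult: "(indet_quot v ^^ D) (p * c) = (indet_quot v ^^ D) p * c" if "indet_quot v c = 0" for D p c
    by (induct D) (auto simp: indet_quot_mult_free that)
  have pow_add: "(indet_quot v ^^ D) (p + c) = (indet_quot v ^^ D) p + (indet_quot v ^^ D) c" for D p c
    by (induct D) (auto simp: indet_quot_add)
  have pow_indet: "(indet_quot v ^^ D) (indet v ^ D * p) = p" for D p
  proof (induct D arbitrary: p)
    case (Suc D)
    have "indet_quot v (indet v ^ Suc D * p) = indet v ^ D * p"
      using indet_quot_indet_mult[of v "indet v ^ D * p"] by (simp only: power_Suc mult.assoc)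
    then show ?case by (simp only: funpow_Suc_right o_apply Suc)
  qed simp
  obtain D where "(indet_quot v ^^ D) f = 0" using indet_quot_nilpotent[of v f] by (elim exE)
  then show ?thesis using f
  proof (induct D arbitrary: f)
    case 0
    then show ?case by (simp add: ideal_zero)
  next
    case (Suc D)
    \<comment> \<open>The coefficient of \<open>v ^ D\<close>, the highest power of \<open>v\<close> that can occur in \<open>f\<close>.\<close>
    let ?c = "(indet_quot v ^^ D) f"
    have "(indet_quot v ^^ Suc D) (f * ?q) = (indet_quot v ^^ Suc D) (indet v * (f * y)) + (indet_quot v ^^ Suc D) f * r"
      by (simp only: distrib_left pow_add mult.left_commute[of f "indet v"] pow_mult[OF free(2)])
    also have "\<dots> = ?c * y"
      unfolding Suc(2) by (simp add: funpow_Suc_right indet_quot_indet_mult pow_mult[OF free(1)] del: funpow.simps(2))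
    finally have "?c * y \<in> ideal_of S" using pow_ideal[OF Suc(3), of "Suc D"] by simp
    then have c: "indet v ^ D * ?c \<in> ideal_of T" by (rule ideal_mult[OF y])
    have "f - indet v ^ D * ?c \<in> ideal_of T"
    proof (rule Suc(1))
      have "(indet_quot v ^^ D) (f - indet v ^ D * ?c + indet v ^ D * ?c) = ?c" by simp
      then show "(indet_quot v ^^ D) (f - indet v ^ D * ?c) = 0"
        unfolding pow_add pow_indet by simp
      show "(f - indet v ^ D * ?c) * ?q \<in> ideal_of S"
        using ideal_diff[OF Suc(3) T'[OF c]] by (simp add: left_diff_distrib)
    qed
    from ideal_add[OF this c] show ?case by simp
  qed
qed

section \<open>Regular sequences and lifting of relations\<close>

text \<open>The head of the list is the last element of the regular sequence. The quotient by the whole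
sequence may be zero.\<close>

fun regular :: "'a::comm_ring_1 list \<Rightarrow> bool" where
  "regular [] \<longleftrightarrow> True"
| "regular (f # fs) \<longleftrightarrow> regular fs \<and> (\<forall>p. p * f \<in> ideal_of (set fs) \<longrightarrow> p \<in> ideal_of (set fs))"

text \<open>The elements \<open>hs\<close> lift \<open>gs\<close> along reduction modulo \<open>y\<close>. A relation among \<open>g0 # gs\<close> whose
coefficient of \<open>g0\<close> is \<open>\<Sum> b i g i\<close> differs from a relation among \<open>gs\<close> by Koszul relations,
and a Koszul relation lifts well: \<open>g i h0 - g0 h i = y (x0 h i - x i h0)\<close>. So the relation,
applied to the lifts, gives \<open>y\<close> times an element of the ideal of the lifts, and not merely a
multiple of \<open>y\<close>.\<close>

lemma lift_relation:
  assumes len: "length hs = length xs" "length gs = length xs"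
    and lift: "\<And>i. i < length xs \<Longrightarrow> hs ! i = gs ! i + y * xs ! i"
    and step: "\<And>a. (\<Sum>i<length xs. a i * gs ! i) = 0 \<Longrightarrow>
      \<exists>p\<in>ideal_of (set hs). (\<Sum>i<length xs. a i * hs ! i) = y * p"
    and rel: "a 0 * g0 + (\<Sum>i<length xs. a (Suc i) * gs ! i) = 0"
    and a0: "a 0 \<in> ideal_of (set gs)"
    and h0: "h0 = g0 + y * x0"
  shows "\<exists>p\<in>ideal_of (set (h0 # hs)). a 0 * h0 + (\<Sum>i<length xs. a (Suc i) * hs ! i) = (y::'a::comm_ring_1) * p"
proof -
  obtain b where b: "a 0 = (\<Sum>i<length xs. b i * gs ! i)"
    using ideal_index_combination[OF a0] len by auto
  have "(\<Sum>i<length xs. (a (Suc i) + b i * g0) * gs ! i) = 0"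
    using rel unfolding b by (simp add: sum_distrib_right sum_distrib_left sum.distrib algebra_simps)
  from step[OF this] obtain p where p: "p \<in> ideal_of (set hs)"
    "(\<Sum>i<length xs. (a (Suc i) + b i * g0) * hs ! i) = y * p" by blast
  let ?q = "\<Sum>i<length xs. b i * (x0 * hs ! i - xs ! i * h0)"
  have "(b i * gs ! i) * h0 - b i * g0 * hs ! i = y * (b i * (x0 * hs ! i - xs ! i * h0))"
    if "i < length xs" for i
    unfolding h0 lift[OF that] by (simp add: algebra_simps)
  then have "(\<Sum>i<length xs. (b i * gs ! i) * h0 - b i * g0 * hs ! i) = y * ?q"
    unfolding sum_distrib_left by (intro sum.cong) auto
  then have "a 0 * h0 - (\<Sum>i<length xs. b i * g0 * hs ! i) = y * ?q"
    unfolding b by (simp add: sum_subtractf sum_distrib_right)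
  then have "a 0 * h0 + (\<Sum>i<length xs. a (Suc i) * hs ! i) = y * (p + ?q)"
    using p(2) by (simp add: sum.distrib algebra_simps)
  moreover have "p + ?q \<in> ideal_of (set (h0 # hs))"
    using len p(1) by (intro ideal_add ideal_sum ideal_mult ideal_diff)
      (auto intro: ideal_base subsetD[OF ideal_mono, of "set hs"])
  ultimately show ?thesis by blast
qed

text \<open>All relations of a regular sequence are generated by Koszul relations.\<close>

lemma lift_relation_regular:
  assumes "length hs = length xs" "length gs = length xs"
    and "\<And>i. i < length xs \<Longrightarrow> hs ! i = gs ! i + y * xs ! i"
    and "regular gs"
    and "(\<Sum>i<length xs. a i * gs ! i) = 0"
  shows "\<exists>p\<in>ideal_of (set hs). (\<Sum>i<length xs. a i * hs ! i) = (y::'a::comm_ring_1) * p"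
  using assms
proof (induct xs arbitrary: gs hs a)
  case Nil
  then show ?case by (auto intro!: bexI[of _ 0] ideal_zero)
next
  case (Cons x0 xs)
  obtain g0 gs' h0 hs' where eq: "gs = g0 # gs'" "hs = h0 # hs'"
    using Cons(2,3) by (metis length_Suc_conv)
  have len: "length hs' = length xs" "length gs' = length xs" using Cons(2,3) by (auto simp: eq)
  have lift: "hs' ! i = gs' ! i + y * xs ! i" if "i < length xs" for i
    using Cons(4)[of "Suc i"] that by (simp add: eq)
  have h0: "h0 = g0 + y * x0" using Cons(4)[of 0] by (simp add: eq)
  have reg: "regular gs'" "\<And>p. p * g0 \<in> ideal_of (set gs') \<Longrightarrow> p \<in> ideal_of (set gs')"
    using Cons(5) by (auto simp: eq)
  have rel: "a 0 * g0 + (\<Sum>i<length xs. a (Suc i) * gs' ! i) = 0"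
    using Cons(6) by (simp add: eq sum.lessThan_Suc_shift del: sum.lessThan_Suc)
  have "a 0 * g0 = - (\<Sum>i<length xs. a (Suc i) * gs' ! i)" using rel by (simp add: add_eq_0_iff2)
  also have "\<dots> \<in> ideal_of (set gs')"
    using len by (intro ideal_uminus ideal_sum ideal_mult ideal_base) auto
  finally have "a 0 \<in> ideal_of (set gs')" by (rule reg(2))
  from lift_relation[OF len lift Cons(1)[OF len lift reg(1)] rel this h0]
  show ?case by (simp add: eq sum.lessThan_Suc_shift del: sum.lessThan_Suc)
qed

section \<open>The linear forms of a generic matrix\<close>

text \<open>Entry \<open>r\<close> of the product of the generic matrix with the generic column, restricted to the
columns \<open>cs\<close>. Lists of columns, and of rows below, allow inductions on the size of the
matrix inside one polynomial ring.\<close>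

definition row_form :: "'n list \<Rightarrow> 'm \<Rightarrow> (('m, 'n) var, 'k::field) mpoly" where
  "row_form cs r = (\<Sum>c\<leftarrow>cs. indet (X r c) * indet (Y c))"

abbreviation Y_indets :: "'n list \<Rightarrow> (('m, 'n) var, 'k::field) mpoly list" where
  "Y_indets cs \<equiv> map (\<lambda>c. indet (Y c)) cs"

lemma row_form_Cons: "row_form (c # cs) r = row_form cs r + indet (Y c) * indet (X r c)"
  by (simp add: row_form_def)

lemma row_form_free_X_other_row: "r \<noteq> r' \<Longrightarrow> indet_quot (X r' c) (row_form cs r) = 0"
  by (induct cs) (auto simp: row_form_def indet_quot_0 indet_quot_add indet_quot_free_mult indet_quot_indet)

lemma row_form_free_X_other_column: "c \<notin> set cs \<Longrightarrow> indet_quot (X r' c) (row_form cs r) = 0"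
  by (induct cs) (auto simp: row_form_def indet_quot_0 indet_quot_add indet_quot_free_mult indet_quot_indet)

lemma row_form_free_Y: "c \<notin> set cs \<Longrightarrow> indet_quot (Y c) (row_form cs r) = 0"
  by (induct cs) (auto simp: row_form_def indet_quot_0 indet_quot_add indet_quot_free_mult indet_quot_indet)

lemma indet_free_part_free: "indet_quot v p = 0 \<Longrightarrow> indet_free_part v p = p"
  by (simp add: indet_free_part_def)

lemma indet_free_part_row_form:
  "c \<notin> set cs \<Longrightarrow> indet_free_part (Y c) (row_form (c # cs) r) = row_form cs r"
  by (simp add: row_form_Cons indet_free_part_add indet_free_part_mult indet_free_part_indet indet_free_part_free row_form_free_Y)

text \<open>Substitute \<open>Y c := 0\<close> in a representation of \<open>f Y c\<close> by the forms; this removes the column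
\<open>c\<close> and leaves a relation among the forms of a smaller matrix. What the substitution
discards is a multiple of \<open>Y c\<close> inside the ideal.\<close>

lemma row_form_relation_mod_Y:
  fixes f :: "(('m, 'n) var, 'k::field) mpoly"
  assumes c: "c \<notin> set cs"
    and f: "f * indet (Y c) \<in> ideal_of (row_form (c # cs) ` set rs)"
  obtains a p where "(\<Sum>i<length rs. a i * row_form cs (rs ! i)) = 0"
    and "p \<in> ideal_of (row_form (c # cs) ` set rs)"
    and "f * indet (Y c) = (\<Sum>i<length rs. a i * row_form (c # cs) (rs ! i)) + indet (Y c) * p"
proof -
  obtain b where b: "f * indet (Y c) = (\<Sum>i<length rs. b i * row_form (c # cs) (rs ! i))"
    using ideal_index_combination[of _ "map (row_form (c # cs)) rs"] f by auto
  let ?a = "\<lambda>i. indet_free_part (Y c) (b i)"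
  have "indet_free_part (Y c) (f * indet (Y c)) = (\<Sum>i<length rs. ?a i * row_form cs (rs ! i))"
    unfolding b indet_free_part_sum indet_free_part_mult indet_free_part_row_form[OF c] ..
  then have "(\<Sum>i<length rs. ?a i * row_form cs (rs ! i)) = 0"
    by (simp add: indet_free_part_mult indet_free_part_indet)
  moreover have "(\<Sum>i<length rs. indet_quot (Y c) (b i) * row_form (c # cs) (rs ! i))
      \<in> ideal_of (row_form (c # cs) ` set rs)"
    by (intro ideal_sum ideal_mult ideal_base) auto
  moreover have "f * indet (Y c) = (\<Sum>i<length rs. ?a i * row_form (c # cs) (rs ! i)) +
      indet (Y c) * (\<Sum>i<length rs. indet_quot (Y c) (b i) * row_form (c # cs) (rs ! i))"
    unfolding b sum_distrib_left sum.distrib[symmetric]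
    by (intro sum.cong refl, subst indet_free_part_decomposition[of "b _" "Y c"]) (simp add: algebra_simps)
  ultimately show ?thesis by (rule that)
qed

text \<open>Induction on the columns. Modulo \<open>Y c\<close> the forms become forms in one column less, so fewer
rows than columns give a regular sequence by the induction hypothesis. Lifting relations
then shows that \<open>Y c\<close> is no zero divisor modulo the forms of these rows. The next form is
\<open>X r c Y c\<close> plus terms without \<open>X r c\<close>, an indeterminate foreign to the earlier forms, and
so it inherits this from its leading coefficient \<open>Y c\<close>.\<close>

theorem regular_row_forms:
  assumes "distinct cs" "distinct rs" "length rs \<le> length cs"
  shows "regular (map (row_form cs) rs :: (('m, 'n) var, 'k::field) mpoly list)"
  using assms
proof (induct cs arbitrary: rs)
  case Nil
  then show ?case by simp
next
  case (Cons c cs)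
  let ?G = "row_form (c # cs) :: 'm \<Rightarrow> (('m, 'n) var, 'k) mpoly"
  \<comment> \<open>\<open>Y c\<close> is a nonzerodivisor modulo the forms of at most \<open>length cs\<close> rows.\<close>
  have nzd: "f \<in> ideal_of (?G ` set rs)"
    if f: "f * indet (Y c) \<in> ideal_of (?G ` set rs)" and rs: "distinct rs" "length rs \<le> length cs" for f rs
  proof -
    have c: "c \<notin> set cs" using Cons(2) by simp
    obtain a p where a: "(\<Sum>i<length rs. a i * row_form cs (rs ! i)) = 0"
      and p: "p \<in> ideal_of (?G ` set rs)"
      and eq: "f * indet (Y c) = (\<Sum>i<length rs. a i * ?G (rs ! i)) + indet (Y c) * p"
      by (rule row_form_relation_mod_Y[OF c f])
    obtain q where q: "q \<in> ideal_of (?G ` set rs)" "(\<Sum>i<length rs. a i * ?G (rs ! i)) = indet (Y c) * q"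
      using lift_relation_regular[of "map ?G rs" "map (\<lambda>r. indet (X r c)) rs" "map (row_form cs) rs" "indet (Y c)" a]
        Cons(1)[of rs] Cons(2) rs a by (auto simp: row_form_Cons)
    have "indet (Y c) * f = indet (Y c) * (q + p)" using eq q(2) by (simp add: algebra_simps)
    then have "f = q + p" by (rule indet_cancel)
    then show ?thesis using q(1) p by (simp add: ideal_add)
  qed
  show ?case using Cons(3,4)
  proof (induct rs)
    case (Cons r rs)
    have "p \<in> ideal_of (?G ` set rs)" if "p * ?G r \<in> ideal_of (?G ` set rs)" for p
    proof (rule leading_coefficient_colon[where v = "X r c" and y = "indet (Y c)" and r = "row_form cs r"])
      show "indet_quot (X r c) s = 0" if "s \<in> ?G ` set rs" for s
        using that Cons(2) row_form_free_X_other_row[of _ r] by fastforce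
      show "indet_quot (X r c) (indet (Y c)) = 0" by (simp add: indet_quot_indet)
      show "indet_quot (X r c) (row_form cs r) = 0"
        using \<open>distinct (c # cs)\<close> by (simp add: row_form_free_X_other_column)
      show "f \<in> ideal_of (?G ` set rs)" if "f * indet (Y c) \<in> ideal_of (?G ` set rs)" for f
        using nzd[OF that] Cons(2,3) by simp
      show "p * (indet (X r c) * indet (Y c) + row_form cs r) \<in> ideal_of (?G ` set rs)"
        using that by (simp add: row_form_Cons algebra_simps)
      show "t * (indet (X r c) * indet (Y c) + row_form cs r) \<in> ideal_of (?G ` set rs)"
        if "t \<in> ?G ` set rs" for t
        using that by (auto intro: ideal_mult_right ideal_base)
    qed
    then show ?case using Cons by simp
  qed simp
qed

lemma regular_indets:
  assumes "distinct cs"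
  shows "regular (Y_indets cs :: (('m, 'n) var, 'k::field) mpoly list)"
  using assms
proof (induct cs)
  case (Cons c cs)
  have "p \<in> ideal_of (set (Y_indets cs))" if "p * indet (Y c) \<in> ideal_of (set (Y_indets cs))"
    for p :: "(('m, 'n) var, 'k) mpoly"
    by (rule leading_coefficient_colon[where v = "Y c" and y = 1 and r = 0 and S = "set (Y_indets cs)"])
      (use that Cons(2) in \<open>auto simp: indet_quot_indet indet_quot_1 indet_quot_0 ideal_mult_right ideal_base\<close>)
  then show ?case using Cons by simp
qed simp


section \<open>The determinant and the colon ideals\<close>

lemma row_form_sum: "row_form cs r = (\<Sum>j<length cs. indet (X r (cs ! j)) * indet (Y (cs ! j)))"
  by (simp add: row_form_def sum_list_sum_nth atLeast0LessThan)

definition generic_mat :: "'m list \<Rightarrow> 'n list \<Rightarrow> (('m, 'n) var, 'k::field) mpoly mat" where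
  "generic_mat rs cs = mat (length rs) (length cs) (\<lambda>(i, j). indet (X (rs ! i) (cs ! j)))"

definition rows_det :: "'m list \<Rightarrow> 'n list \<Rightarrow> (('m, 'n) var, 'k::field) mpoly" where
  "rows_det rs cs = det (generic_mat rs cs)"

lemma generic_mat_carrier: "length rs = length cs \<Longrightarrow> generic_mat rs cs \<in> carrier_mat (length cs) (length cs)"
  by (simp add: generic_mat_def)

text \<open>The product of the adjugate with the matrix. Column \<open>k\<close> of the cofactor matrix annihilates
all columns of the matrix except column \<open>k\<close>.\<close>

lemma cofactor_sum:
  assumes "length rs = length cs" "k < length cs" "j < length cs"
  shows "(\<Sum>i<length cs. cofactor (generic_mat rs cs) i k * indet (X (rs ! i) (cs ! j))) =
    (if k = j then rows_det rs cs else 0)"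
proof -
  note A = generic_mat_carrier[OF assms(1)]
  have "(\<Sum>i<length cs. cofactor (generic_mat rs cs) i k * indet (X (rs ! i) (cs ! j))) =
      (adj_mat (generic_mat rs cs) * generic_mat rs cs) $$ (k, j)"
    using assms adj_mat(1)[OF A]
    by (simp add: scalar_prod_def atLeast0LessThan adj_mat_def generic_mat_def)
  also have "\<dots> = (if k = j then rows_det rs cs else 0)"
    unfolding adj_mat(3)[OF A] using assms by (simp add: rows_det_def)
  finally show ?thesis .
qed

lemma cofactor_row_form_sum:
  assumes "length rs = length cs" "k < length cs"
  shows "(\<Sum>i<length cs. cofactor (generic_mat rs cs) i k * row_form cs (rs ! i)) =
    rows_det rs cs * indet (Y (cs ! k))"
proof -
  let ?C = "\<lambda>i. cofactor (generic_mat rs cs) i k"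
  have "(\<Sum>i<length cs. ?C i * row_form cs (rs ! i)) =
      (\<Sum>i<length cs. \<Sum>j<length cs. ?C i * indet (X (rs ! i) (cs ! j)) * indet (Y (cs ! j)))"
    by (simp add: row_form_sum sum_distrib_left mult.assoc)
  also have "\<dots> = (\<Sum>j<length cs. (\<Sum>i<length cs. ?C i * indet (X (rs ! i) (cs ! j))) * indet (Y (cs ! j)))"
    unfolding sum_distrib_right by (rule sum.swap)
  also have "\<dots> = (\<Sum>j<length cs. (if k = j then rows_det rs cs else 0) * indet (Y (cs ! j)))"
    by (intro sum.cong) (simp_all add: cofactor_sum[OF assms])
  also have "\<dots> = rows_det rs cs * indet (Y (cs ! k))"
    using assms(2) by (simp add: if_distrib[of "\<lambda>x. x * _"] sum.delta cong: if_cong)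
  finally show ?thesis .
qed

lemma row_form_in_indets: "row_form cs r \<in> ideal_of (set (Y_indets cs))"
  unfolding row_form_sum by (intro ideal_sum ideal_mult ideal_base) auto

text \<open>Cramer's rule: the determinant times an entry of the column lies in the ideal of the forms.\<close>

lemma minor_mult_indet:
  fixes cs :: "'n list" and rs :: "'m list"
  assumes "length rs = length cs" "p \<in> ideal_of (set (Y_indets cs))"
  shows "rows_det rs cs * p \<in> (ideal_of (row_form cs ` set rs) :: (('m, 'n) var, 'k::field) mpoly set)"
  using assms(2)
proof (induct rule: ideal_induct)
  case base show ?case by (simp add: ideal_zero)
next
  case (step c x y)
  then obtain j where j: "j < length cs" "x = indet (Y (cs ! j))" by (auto simp: in_set_conv_nth)
  have "rows_det rs cs * x \<in> ideal_of (row_form cs ` set rs)"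
    unfolding j(2) cofactor_row_form_sum[OF assms(1) j(1), symmetric]
    using assms(1) by (intro ideal_sum ideal_mult[OF ideal_base]) simp
  from ideal_add[OF ideal_mult[OF this, of c] step(2)] show ?case
    by (simp add: distrib_left mult.left_commute)
qed

lemma minor_mult_row_form:
  "length rs = length cs \<Longrightarrow> rows_det rs cs * row_form cs r \<in> ideal_of (row_form cs ` set rs)"
  by (intro minor_mult_indet row_form_in_indets)

lemma rows_det_Nil: "rows_det [] [] = 1"
  by (simp add: rows_det_def generic_mat_def det_def)

lemma indet_quot_free_det:
  assumes "A \<in> carrier_mat n n" "\<And>i j. i < n \<Longrightarrow> j < n \<Longrightarrow> indet_quot v (A $$ (i, j)) = 0"
  shows "indet_quot v (det A) = 0"
  unfolding det_def'[OF assms(1)]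
  by (intro indet_quot_free_sum indet_quot_free_mult indet_quot_free_prod indet_quot_free_of_int assms)
     (auto simp: permutes_in_image)

lemma cofactor_free:
  assumes "c \<notin> set cs" "length rs = length (c # cs)"
  shows "indet_quot (X r c) (cofactor (generic_mat rs (c # cs)) i 0) = 0"
proof -
  have "mat_delete (generic_mat rs (c # cs)) i 0 \<in> carrier_mat (length cs) (length cs)"
    using mat_delete_carrier[OF generic_mat_carrier[OF assms(2)], of i 0] by simp
  moreover have "indet_quot (X r c) (mat_delete (generic_mat rs (c # cs)) i 0 $$ (i', j')) = 0"
    if "i' < length cs" "j' < length cs" for i' j'
    using that assms by (auto simp: mat_delete_def generic_mat_def indet_quot_indet)
  ultimately have "indet_quot (X r c) (det (mat_delete (generic_mat rs (c # cs)) i 0)) = 0"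
    by (rule indet_quot_free_det)
  then show ?thesis
    using indet_quot_free_mult[OF indet_quot_free_of_int[of _ "(-1) ^ i"]] by (simp add: cofactor_def)
qed

lemma cofactor_0_0:
  "cofactor (generic_mat (r # rs) (c # cs)) 0 0 = rows_det rs cs"
  unfolding cofactor_def rows_det_def
  by (auto intro!: arg_cong[where f = det] eq_matI simp: mat_delete_def generic_mat_def)

text \<open>Again by induction on the columns, now for as many forms as columns, where \<open>Y c\<close> may be a
zero divisor modulo the ideal \<open>I\<close> of the forms. Suppose that \<open>h Y c\<close> is in \<open>I\<close>. Modulo \<open>Y c\<close>
this is a relation among one more form than there are columns. The coefficient of its first
form lies in the colon ideal that the induction hypothesis describes. Therefore, up to a
multiple of the relation given by the cofactors of column \<open>c\<close>, it is a relation that lifts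
by Koszul relations. The lift of the cofactor relation is \<open>\<Delta> Y c\<close>, with \<open>\<Delta>\<close> the determinant,
whence \<open>h\<close> is in \<open>I + (\<Delta>)\<close>. The passage from \<open>Y c\<close> to the form of a further row \<open>r\<close> is by
leading coefficients in \<open>X r c\<close>.\<close>

theorem colon_row_form:
  fixes f :: "(('m, 'n) var, 'k::field) mpoly"
  assumes "distinct cs" "distinct (r # rs)" "length rs = length cs"
    and "f * row_form cs r \<in> ideal_of (row_form cs ` set rs)"
  shows "f \<in> ideal_of (insert (rows_det rs cs) (row_form cs ` set rs))"
  using assms
proof (induct cs arbitrary: r rs f)
  case Nil
  then show ?case
    using ideal_mult[OF ideal_base, of 1 "{1}" f] by (simp add: rows_det_Nil)
next
  case (Cons c cs)
  let ?G = "row_form (c # cs) :: 'm \<Rightarrow> (('m, 'n) var, 'k) mpoly"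
  obtain r1 rs' where rs: "rs = r1 # rs'" using Cons(4) by (cases rs) auto
  let ?T = "insert (rows_det rs (c # cs)) (?G ` set rs)"
  have c: "c \<notin> set cs" and dist: "distinct cs" "distinct (r1 # rs')" "length rs' = length cs"
    using Cons(2-4) by (auto simp: rs)
  have nzd: "h \<in> ideal_of ?T" if h: "h * indet (Y c) \<in> ideal_of (?G ` set rs)" for h
  proof -
    obtain a p where a: "(\<Sum>i<length rs. a i * row_form cs (rs ! i)) = 0"
      and p: "p \<in> ideal_of (?G ` set rs)"
      and eq: "h * indet (Y c) = (\<Sum>i<length rs. a i * ?G (rs ! i)) + indet (Y c) * p"
      by (rule row_form_relation_mod_Y[OF c h])
    have "a 0 * row_form cs r1 = - (\<Sum>i<length rs'. a (Suc i) * row_form cs (rs' ! i))"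
      using a by (simp add: rs add_eq_0_iff2 sum.lessThan_Suc_shift del: sum.lessThan_Suc)
    also have "\<dots> \<in> ideal_of (row_form cs ` set rs')"
      by (intro ideal_uminus ideal_sum ideal_mult ideal_base) auto
    finally obtain k where k: "a 0 - k * rows_det rs' cs \<in> ideal_of (row_form cs ` set rs')"
      using Cons(1)[OF dist] unfolding ideal_insert_iff by blast
    \<comment> \<open>The cofactors of column \<open>c\<close>: a relation for the forms in \<open>cs\<close>, and \<open>\<Delta> Y c\<close> for those in \<open>c # cs\<close>.\<close>
    let ?C = "\<lambda>i. cofactor (generic_mat rs (c # cs)) i 0 :: (('m, 'n) var, 'k) mpoly"
    have len: "length rs = length (c # cs)" "length rs = Suc (length rs')" by (simp_all add: rs dist)
    have C: "(\<Sum>i<length rs. ?C i * ?G (rs ! i)) = rows_det rs (c # cs) * indet (Y c)"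
      using cofactor_row_form_sum[OF len(1), of 0] unfolding len(1) by simp
    have CX: "(\<Sum>i<length rs. ?C i * indet (X (rs ! i) c)) = rows_det rs (c # cs)"
      using cofactor_sum[OF len(1), of 0 0] unfolding len(1) by simp
    have "(\<Sum>i<length rs. ?C i * ?G (rs ! i)) = (\<Sum>i<length rs. ?C i * row_form cs (rs ! i)) +
        (\<Sum>i<length rs. ?C i * indet (X (rs ! i) c)) * indet (Y c)"
      unfolding row_form_Cons sum_distrib_right sum.distrib[symmetric]
      by (intro sum.cong refl) (simp add: algebra_simps)
    then have C0: "(\<Sum>i<length rs. ?C i * row_form cs (rs ! i)) = 0"
      unfolding C CX by simp
    \<comment> \<open>Adjust the relation so that its coefficient of \<open>r1\<close> falls into the ideal of the other forms.\<close>
    let ?a = "\<lambda>i. a i - k * ?C i"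
    have "(\<Sum>i<length rs. ?a i * row_form cs (rs ! i)) = 0"
      using a C0 by (simp add: left_diff_distrib sum_subtractf mult.assoc flip: sum_distrib_left)
    then have rel: "?a 0 * row_form cs r1 + (\<Sum>i<length rs'. ?a (Suc i) * row_form cs (rs' ! i)) = 0"
      by (simp add: rs sum.lessThan_Suc_shift del: sum.lessThan_Suc)
    define xs where "xs = map (\<lambda>r. indet (X r c) :: (('m, 'n) var, 'k) mpoly) rs'"
    let ?gs = "map (row_form cs) rs' :: (('m, 'n) var, 'k) mpoly list" and ?hs = "map ?G rs'"
    have xs: "length ?hs = length xs" "length ?gs = length xs"
      "\<And>i. i < length xs \<Longrightarrow> ?hs ! i = ?gs ! i + indet (Y c) * xs ! i"
      by (simp_all add: xs_def row_form_Cons)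
    have reg: "regular ?gs" using regular_row_forms[of cs rs'] dist by simp
    have rel': "?a 0 * row_form cs r1 + (\<Sum>i<length xs. ?a (Suc i) * ?gs ! i) = 0"
      using rel by (simp add: xs_def)
    have a0: "?a 0 \<in> ideal_of (set ?gs)" using k by (simp add: rs cofactor_0_0)
    obtain q where q: "q \<in> ideal_of (set (?G r1 # ?hs))"
      "?a 0 * ?G r1 + (\<Sum>i<length xs. ?a (Suc i) * ?hs ! i) = indet (Y c) * q"
      using lift_relation[OF xs lift_relation_regular[OF xs reg] rel' a0 row_form_Cons] by blast
    have q: "q \<in> ideal_of (?G ` set rs)" "(\<Sum>i<length rs. ?a i * ?G (rs ! i)) = indet (Y c) * q"
      using q by (auto simp: xs_def rs sum.lessThan_Suc_shift simp del: sum.lessThan_Suc)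
    have "(\<Sum>i<length rs. a i * ?G (rs ! i)) =
        (\<Sum>i<length rs. ?a i * ?G (rs ! i)) + k * (\<Sum>i<length rs. ?C i * ?G (rs ! i))"
      by (simp add: sum_distrib_left left_diff_distrib sum_subtractf mult.assoc)
    then have "indet (Y c) * h = indet (Y c) * (q + k * rows_det rs (c # cs) + p)"
      using eq unfolding q(2) C by (simp add: algebra_simps)
    then have "h = q + k * rows_det rs (c # cs) + p" by (rule indet_cancel)
    moreover have "ideal_of (?G ` set rs) \<subseteq> ideal_of ?T" by (rule ideal_mono) blast
    ultimately show ?thesis
      using p q(1) ideal_mult[OF ideal_base, of "rows_det rs (c # cs)" ?T k] by (auto intro!: ideal_add)
  qed
  show ?case
  proof (rule leading_coefficient_colon[where v = "X r c" and y = "indet (Y c)" and r = "row_form cs r"])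
    show "indet_quot (X r c) s = 0" if "s \<in> ?G ` set rs" for s
      using that Cons(3) row_form_free_X_other_row[of _ r] by fastforce
    show "indet_quot (X r c) (indet (Y c)) = 0" by (simp add: indet_quot_indet)
    show "indet_quot (X r c) (row_form cs r) = 0" using c by (simp add: row_form_free_X_other_column)
    have G: "indet (X r c) * indet (Y c) + row_form cs r = ?G r"
      by (simp add: row_form_Cons algebra_simps)
    show "f * (indet (X r c) * indet (Y c) + row_form cs r) \<in> ideal_of (?G ` set rs)"
      unfolding G by (rule Cons(5))
    show "t * (indet (X r c) * indet (Y c) + row_form cs r) \<in> ideal_of (?G ` set rs)" if "t \<in> ?T" for t
      unfolding G using that minor_mult_row_form[OF Cons(4)] by (auto intro: ideal_mult_right ideal_base)
  qed (rule nzd)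
qed

text \<open>The determinant involves none of the \<open>Y c\<close> and is therefore a nonzerodivisor modulo them.
Expanding along the first column, its leading coefficient in the indeterminate \<open>X r c\<close> is
the determinant of a smaller matrix.\<close>

lemma colon_minor:
  fixes f :: "(('m, 'n) var, 'k::field) mpoly"
  assumes "distinct cs" "distinct rs" "length rs = length cs"
    and "f * rows_det rs cs \<in> ideal_of (set (Y_indets ds))"
  shows "f \<in> ideal_of (set (Y_indets ds))"
  using assms
proof (induct cs arbitrary: rs f)
  case Nil
  then show ?case by (simp add: rows_det_Nil)
next
  case (Cons c cs)
  obtain r rs' where rs: "rs = r # rs'" using Cons(4) by (cases rs) auto
  let ?C = "\<lambda>i. cofactor (generic_mat rs (c # cs)) i 0 :: (('m, 'n) var, 'k) mpoly"
  let ?R = "\<Sum>i<length rs'. ?C (Suc i) * indet (X (rs' ! i) c)"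
  have c: "c \<notin> set cs" and r: "r \<notin> set rs'" using Cons(2,3) by (auto simp: rs)
  have "rows_det rs (c # cs) = (\<Sum>i<Suc (length rs'). ?C i * indet (X (rs ! i) c))"
    using cofactor_sum[OF Cons(4), of 0 0, symmetric] Cons(4) by (simp add: rs del: sum.lessThan_Suc)
  also have "\<dots> = indet (X r c) * rows_det rs' cs + ?R"
    unfolding sum.lessThan_Suc_shift by (simp add: rs cofactor_0_0 mult.commute)
  finally have minor: "rows_det rs (c # cs) = indet (X r c) * rows_det rs' cs + ?R" .
  show ?case
  proof (rule leading_coefficient_colon[where v = "X r c" and y = "rows_det rs' cs" and r = ?R])
    show "indet_quot (X r c) s = 0" if "s \<in> set (Y_indets ds)" for s :: "(('m, 'n) var, 'k) mpoly"
      using that by (auto simp: indet_quot_indet)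
    show "indet_quot (X r c) (rows_det rs' cs) = 0"
      using cofactor_free[OF c Cons(4), of r 0] unfolding rs cofactor_0_0 .
    show "indet_quot (X r c) ?R = 0"
      using r by (intro indet_quot_free_sum indet_quot_free_mult cofactor_free[OF c Cons(4)]) (auto simp: indet_quot_indet)
    show "h \<in> ideal_of (set (Y_indets ds))"
      if "h * rows_det rs' cs \<in> ideal_of (set (Y_indets ds))" for h :: "(('m, 'n) var, 'k) mpoly"
      using Cons(1)[OF _ _ _ that] Cons(2-4) by (auto simp: rs)
    show "f * (indet (X r c) * rows_det rs' cs + ?R) \<in> ideal_of (set (Y_indets ds))"
      using Cons(5) unfolding minor .
  qed (auto intro: ideal_mult_right ideal_base)
qed

section \<open>The standard grading\<close>

lemma monom_degree_plus: "monom_degree (s + t) = monom_degree s + monom_degree t"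
  unfolding monom_degree_def by (rule setsum_keys_plus_distrib[where f = "\<lambda>_ x. x"]) auto

lemma monom_degree_eq_0: "monom_degree t = 0 \<longleftrightarrow> t = 0"
  by (auto simp: monom_degree_def in_keys_iff poly_mapping_eq_iff fun_eq_iff)

lemma monomial_add_eq_0: "s + t = (0 :: 'v \<Rightarrow>\<^sub>0 nat) \<longleftrightarrow> s = 0 \<and> t = 0"
  by (metis add_is_0 monom_degree_eq_0 monom_degree_plus)

definition homogeneous_part :: "int \<Rightarrow> ('v, 'k::field) mpoly \<Rightarrow> ('v, 'k) mpoly" where
  "homogeneous_part e p = Abs_poly_mapping (\<lambda>t. Poly_Mapping.lookup p t when int (monom_degree t) = e)"

lemma lookup_homogeneous_part:
  "Poly_Mapping.lookup (homogeneous_part e p) t = (if int (monom_degree t) = e then Poly_Mapping.lookup p t else 0)"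
proof -
  have "finite {t. (Poly_Mapping.lookup p t when int (monom_degree t) = e) \<noteq> 0}"
    by (rule finite_subset[OF _ finite_lookup[of p]]) (auto simp: when_def)
  then show ?thesis by (simp add: homogeneous_part_def when_def)
qed

lemma homogeneous_iff: "homogeneous e p \<longleftrightarrow> (\<forall>t. Poly_Mapping.lookup p t \<noteq> 0 \<longrightarrow> int (monom_degree t) = e)"
  by (auto simp: homogeneous_def in_keys_iff)

lemma homogeneous_0: "homogeneous e 0"
  and homogeneous_add: "homogeneous e p \<Longrightarrow> homogeneous e q \<Longrightarrow> homogeneous e (p + q)"
  and homogeneous_uminus: "homogeneous e p \<Longrightarrow> homogeneous e (- p)"
  and homogeneous_homogeneous_part: "homogeneous e (homogeneous_part e p)"
  by (auto simp: homogeneous_iff lookup_add lookup_homogeneous_part) (metis add.right_neutral)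

lemma homogeneous_sum: "(\<And>x. x \<in> A \<Longrightarrow> homogeneous e (f x)) \<Longrightarrow> homogeneous e (sum f A)"
  by (induct A rule: infinite_finite_induct) (auto simp: homogeneous_0 homogeneous_add)

lemma homogeneous_mult: "homogeneous d p \<Longrightarrow> homogeneous e q \<Longrightarrow> homogeneous (d + e) (p * q)"
  unfolding homogeneous_def using keys_mult[of p q] by (fastforce simp: monom_degree_plus)

lemma homogeneous_1: "homogeneous 0 1"
  by (auto simp: homogeneous_iff lookup_one when_def monom_degree_eq_0)

lemma homogeneous_prod: "finite A \<Longrightarrow> (\<And>x. x \<in> A \<Longrightarrow> homogeneous 1 (f x)) \<Longrightarrow> homogeneous (int (card A)) (prod f A)"
proof (induct A rule: finite_induct)
  case (insert x A)
  then show ?case using homogeneous_mult[of 1 "f x" "int (card A)" "prod f A"] by simp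
qed (simp add: homogeneous_1)

lemma homogeneous_indet: "homogeneous 1 (indet v)"
  by (auto simp: homogeneous_iff indet_def lookup_single when_def monom_degree_def)

lemma homogeneous_part_add: "homogeneous_part e (p + q) = homogeneous_part e p + homogeneous_part e q"
  and homogeneous_part_0: "homogeneous_part e 0 = 0"
  by (rule poly_mapping_eqI, simp add: lookup_homogeneous_part lookup_add)+

lemma homogeneous_part_sum: "homogeneous_part e (sum f A) = (\<Sum>x\<in>A. homogeneous_part e (f x))"
  by (induct A rule: infinite_finite_induct) (auto simp: homogeneous_part_add homogeneous_part_0)

lemma homogeneous_part_homogeneous: "homogeneous d p \<Longrightarrow> homogeneous_part e p = (if d = e then p else 0)"
  by (rule poly_mapping_eqI) (auto simp: lookup_homogeneous_part homogeneous_iff)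

text \<open>The part of degree \<open>e\<close> of a product with a homogeneous factor comes from one part of the
other factor.\<close>

lemma homogeneous_part_mult:
  assumes "homogeneous d q"
  shows "homogeneous_part e (p * q) = homogeneous_part (e - d) p * q"
proof (induct p rule: single_induct)
  case (single t c)
  have t: "homogeneous (int (monom_degree t)) (Poly_Mapping.single t c)"
    by (auto simp: homogeneous_iff lookup_single when_def)
  show ?case
    unfolding homogeneous_part_homogeneous[OF homogeneous_mult[OF t assms]] homogeneous_part_homogeneous[OF t] by auto
qed (auto simp: homogeneous_part_0 distrib_right homogeneous_part_add)

definition const_coeff :: "('v, 'k::field) mpoly \<Rightarrow> 'k" where
  "const_coeff p = Poly_Mapping.lookup p 0"

lemma const_coeff_hom [simp]:
  "const_coeff 0 = 0" "const_coeff 1 = 1" "const_coeff (p + q) = const_coeff p + const_coeff q"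
  by (simp_all add: const_coeff_def lookup_add)

lemma const_coeff_mult [simp]: "const_coeff (p * q) = const_coeff p * const_coeff q"
proof -
  have "const_coeff (Poly_Mapping.single t c * q) = const_coeff (Poly_Mapping.single t c) * const_coeff q" for t c
    by (induct q rule: single_induct)
      (auto simp: mult_single const_coeff_def lookup_single when_def monomial_add_eq_0 distrib_left lookup_add)
  then show ?thesis by (induct p rule: single_induct) (simp_all add: distrib_right)
qed

lemma const_coeff_sum: "const_coeff (sum f A) = (\<Sum>x\<in>A. const_coeff (f x))"
  by (induct A rule: infinite_finite_induct) auto

text \<open>A monomial other than \<open>1\<close> is divisible by some indeterminate.\<close>

lemma irrelevant_ideal_iff: "p \<in> irrelevant_ideal \<longleftrightarrow> const_coeff p = 0"
proof
  assume "p \<in> irrelevant_ideal"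
  then show "const_coeff p = 0" unfolding irrelevant_ideal_def
  proof (induct rule: ideal_induct)
    case (step c x y)
    have "const_coeff (indet v) = 0" for v :: 'a
      by (auto simp: const_coeff_def indet_def lookup_single when_def monom_degree_eq_0[symmetric] monom_degree_def)
    then show ?case using step by auto
  qed simp
next
  assume p: "const_coeff p = 0"
  have "Poly_Mapping.single t (Poly_Mapping.lookup p t) \<in> irrelevant_ideal" if "t \<in> Poly_Mapping.keys p" for t
  proof -
    have "t \<noteq> 0" using p that by (auto simp: const_coeff_def)
    then obtain v where v: "Poly_Mapping.lookup t v \<noteq> 0" by (metis lookup_zero poly_mapping_eqI)
    have "Poly_Mapping.single t (Poly_Mapping.lookup p t) =
        indet v * Poly_Mapping.single (t - Poly_Mapping.single v 1) (Poly_Mapping.lookup p t)"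
      unfolding indet_mult_single monomial_minus_plus[OF v] ..
    then show ?thesis unfolding irrelevant_ideal_def by (auto intro: ideal_mult_right ideal_base)
  qed
  then show "p \<in> irrelevant_ideal"
    by (subst single_decomposition) (auto simp: irrelevant_ideal_def intro: ideal_sum)
qed

lemma homogeneous_const_coeff: "homogeneous e p \<Longrightarrow> e \<noteq> 0 \<Longrightarrow> const_coeff p = 0"
  by (auto simp: homogeneous_iff const_coeff_def monom_degree_def)

lemma homogeneous_0_const:
  assumes "homogeneous 0 p" shows "p = Poly_Mapping.single 0 (const_coeff p)"
  using assms by (intro poly_mapping_eqI) (auto simp: homogeneous_iff lookup_single when_def const_coeff_def monom_degree_eq_0)

lemma homogeneous_0_dvd_1:
  assumes "homogeneous 0 p" "p \<noteq> 0" shows "p dvd 1"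
proof -
  have "const_coeff p \<noteq> 0" using homogeneous_0_const[OF assms(1)] assms(2) by auto
  then have "p * Poly_Mapping.single 0 (inverse (const_coeff p)) = 1"
    by (subst homogeneous_0_const[OF assms(1)]) (simp add: mult_single)
  then show ?thesis by (metis dvd_triv_left)
qed

lemma homogeneous_row_form: "homogeneous 2 (row_form cs r)"
  unfolding row_form_sum using homogeneous_mult[OF homogeneous_indet homogeneous_indet]
  by (intro homogeneous_sum) simp

lemma homogeneous_rows_det:
  assumes "length rs = length cs"
  shows "homogeneous (int (length cs)) (rows_det rs cs)"
proof -
  have "homogeneous (int (length cs)) (signof p * (\<Prod>i = 0..<length cs. generic_mat rs cs $$ (i, p i)))"
    if p: "p permutes {0..<length cs}" for p
  proof -
    have "homogeneous (int (card {0..<length cs})) (\<Prod>i = 0..<length cs. generic_mat rs cs $$ (i, p i))"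
      using assms permutes_in_image[OF p]
      by (intro homogeneous_prod) (auto simp: generic_mat_def homogeneous_indet)
    then show ?thesis by (auto simp: sign_def homogeneous_uminus)
  qed
  then show ?thesis
    unfolding rows_det_def det_def'[OF generic_mat_carrier[OF assms]] by (intro homogeneous_sum) auto
qed

section \<open>Exact sequences of free modules, chain maps and homotopies\<close>

lemma carrier_vec_0: "carrier_vec 0 = {0\<^sub>v 0}"
proof (intro subset_antisym subsetI)
  fix v :: "'a vec" assume "v \<in> carrier_vec 0"
  then have "v = 0\<^sub>v 0" by (intro eq_vecI) auto
  then show "v \<in> {0\<^sub>v 0}" by simp
qed simp

lemma trivial_kernel:
  fixes A :: "'a::comm_ring_1 mat"
  assumes "A \<in> carrier_mat m 0" "B \<in> carrier_mat 0 k"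
  shows "mat_kernel A = (\<lambda>w. B *\<^sub>v w) ` carrier_vec k"
proof -
  have "A *\<^sub>v 0\<^sub>v 0 = 0\<^sub>v m" using assms(1) by (intro eq_vecI) (auto simp: scalar_prod_def)
  then have "mat_kernel A = {0\<^sub>v 0}"
    unfolding mat_kernel[OF assms(1)] carrier_vec_0 by auto
  moreover have "B *\<^sub>v w = 0\<^sub>v 0" for w using assms(2) by (intro eq_vecI) auto
  then have "(\<lambda>w. B *\<^sub>v w) ` carrier_vec k = {0\<^sub>v 0}"
    by (auto intro!: image_eqI[of _ _ "0\<^sub>v k"])
  ultimately show ?thesis by simp
qed

lemma mult_mat_unit_vec:
  fixes A :: "'a::comm_ring_1 mat"
  assumes "A \<in> carrier_mat m n" "c < n"
  shows "A *\<^sub>v unit_vec n c = col A c"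
  using assms by (intro eq_vecI) auto

text \<open>Exactness at \<open>F 1, F 2, \<dots>\<close> only; the cokernel of \<open>D 0\<close> is treated separately, because it is
not free.\<close>

definition exact_seq :: "(nat \<Rightarrow> nat) \<Rightarrow> (nat \<Rightarrow> 'a::comm_ring_1 mat) \<Rightarrow> bool" where
  "exact_seq b D \<longleftrightarrow>
     (\<forall>i. D i \<in> carrier_mat (b i) (b (Suc i))) \<and>
     (\<forall>i. mat_kernel (D i) = (\<lambda>w. D (Suc i) *\<^sub>v w) ` carrier_vec (b (Suc (Suc i))))"

lemma exact_seqD:
  assumes "exact_seq b D"
  shows "D i \<in> carrier_mat (b i) (b (Suc i))"
    and "mat_kernel (D i) = (\<lambda>w. D (Suc i) *\<^sub>v w) ` carrier_vec (b (Suc (Suc i)))"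
  using assms by (auto simp: exact_seq_def)

lemma factor_through_columns:
  fixes D :: "'a::comm_ring_1 mat"
  assumes D: "D \<in> carrier_mat r m" and M: "M \<in> carrier_mat r k"
    and cols: "\<And>c. c < k \<Longrightarrow> col M c \<in> (\<lambda>w. D *\<^sub>v w) ` carrier_vec m"
  shows "\<exists>N\<in>carrier_mat m k. M = D * N"
proof -
  have "\<forall>c\<in>{..<k}. \<exists>w. w \<in> carrier_vec m \<and> col M c = D *\<^sub>v w" using cols by auto
  then obtain w where w: "\<forall>c\<in>{..<k}. w c \<in> carrier_vec m \<and> col M c = D *\<^sub>v w c"
    by (rule bchoice[THEN exE])
  let ?N = "mat m k (\<lambda>(i, c). w c $ i)"
  have "dim_vec (w c) = m" if "c < k" for c using w that by (meson carrier_vecD lessThan_iff)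
  then have "col ?N c = w c" if "c < k" for c using that by (intro eq_vecI) auto
  then have "M = D * ?N"
    using D M w by (intro mat_col_eqI) (auto simp: col_mult2[of D r m ?N k])
  then show ?thesis by (intro bexI[of _ ?N]) auto
qed

lemma exact_factor:
  assumes ex: "exact_seq b D" and M: "M \<in> carrier_mat (b (Suc i)) k"
    and zero: "D i * M = 0\<^sub>m (b i) k"
  shows "\<exists>N\<in>carrier_mat (b (Suc (Suc i))) k. M = D (Suc i) * N"
proof (rule factor_through_columns[OF exact_seqD(1)[OF ex] M])
  fix c assume c: "c < k"
  have "D i *\<^sub>v col M c = col (D i * M) c" using col_mult2[OF exact_seqD(1)[OF ex] M c] by simp
  also have "\<dots> = 0\<^sub>v (b i)" unfolding zero using c by simp
  finally have "col M c \<in> mat_kernel (D i)"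
    using M by (intro mat_kernelI[OF exact_seqD(1)[OF ex]] carrier_vecI) simp_all
  then show "col M c \<in> (\<lambda>w. D (Suc i) *\<^sub>v w) ` carrier_vec (b (Suc (Suc i)))"
    unfolding exact_seqD(2)[OF ex] .
qed

lemma exact_comp_zero:
  assumes ex: "exact_seq b D"
  shows "D i * D (Suc i) = 0\<^sub>m (b i) (b (Suc (Suc i)))"
proof (rule mat_col_eqI)
  note c = exact_seqD(1)[OF ex]
  fix j assume "j < dim_col (0\<^sub>m (b i) (b (Suc (Suc i))) :: 'a mat)"
  then have j: "j < b (Suc (Suc i))" by simp
  have "col (D (Suc i)) j = D (Suc i) *\<^sub>v unit_vec (b (Suc (Suc i))) j"
    using c[of "Suc i"] j by (intro eq_vecI) auto
  also have "\<dots> \<in> mat_kernel (D i)" unfolding exact_seqD(2)[OF ex] by auto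
  finally have "D i *\<^sub>v col (D (Suc i)) j = 0\<^sub>v (b i)" by (rule mat_kernelD[OF c])
  then show "col (D i * D (Suc i)) j = col (0\<^sub>m (b i) (b (Suc (Suc i)))) j"
    using col_mult2[OF c c j] j by simp
qed (use exact_seqD(1)[OF ex] in auto)

text \<open>The comparison theorem: the source consists of free modules and may be any complex, the
target is exact. Each square is filled by lifting the images of the basis vectors.\<close>

lemma chain_map_extension:
  fixes D :: "nat \<Rightarrow> 'a::comm_ring_1 mat"
  assumes D: "\<And>i. D i \<in> carrier_mat (b i) (b (Suc i))"
    and D0: "\<And>i. D i * D (Suc i) = 0\<^sub>m (b i) (b (Suc (Suc i)))"
    and ex: "exact_seq b' D'"
    and \<alpha>0: "\<alpha>0 \<in> carrier_mat (b' 0) (b 0)"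
    and start: "\<And>c. c < b 1 \<Longrightarrow> col (\<alpha>0 * D 0) c \<in> (\<lambda>w. D' 0 *\<^sub>v w) ` carrier_vec (b' 1)"
  shows "\<exists>\<alpha>. \<alpha> 0 = \<alpha>0 \<and> (\<forall>i. \<alpha> i \<in> carrier_mat (b' i) (b i)) \<and>
    (\<forall>i. \<alpha> i * D i = D' i * \<alpha> (Suc i))"
proof -
  note D' = exact_seqD(1)[OF ex]
  let ?P = "\<lambda>i A. A \<in> carrier_mat (b' i) (b i) \<and> (i = 0 \<longrightarrow> A = \<alpha>0) \<and>
    (\<exists>N\<in>carrier_mat (b' (Suc i)) (b (Suc i)). A * D i = D' i * N)"
  have "\<exists>\<alpha>. \<forall>i. ?P i (\<alpha> i) \<and> \<alpha> i * D i = D' i * \<alpha> (Suc i)"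
  proof (rule dependent_nat_choice)
    have "\<exists>N\<in>carrier_mat (b' 1) (b 1). \<alpha>0 * D 0 = D' 0 * N"
      by (rule factor_through_columns[OF _ _ start]) (use D[of 0] D'[of 0] \<alpha>0 in auto)
    then show "\<exists>A. ?P 0 A" using \<alpha>0 by auto
  next
    fix A i assume "?P i A"
    then obtain N where A: "A \<in> carrier_mat (b' i) (b i)"
      and N: "N \<in> carrier_mat (b' (Suc i)) (b (Suc i))" "A * D i = D' i * N" by auto
    have "D' i * (N * D (Suc i)) = A * D i * D (Suc i)"
      unfolding N(2) using assoc_mult_mat[OF D' N(1) D] ..
    also have "\<dots> = A * (D i * D (Suc i))" by (rule assoc_mult_mat[OF A D D])
    also have "\<dots> = 0\<^sub>m (b' i) (b (Suc (Suc i)))" unfolding D0 using A by simp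
    finally have "\<exists>N'\<in>carrier_mat (b' (Suc (Suc i))) (b (Suc (Suc i))). N * D (Suc i) = D' (Suc i) * N'"
      using N(1) D[of "Suc i"] by (intro exact_factor[OF ex]) auto
    then show "\<exists>A'. ?P (Suc i) A' \<and> A * D i = D' i * A'" using N by auto
  qed
  then show ?thesis by blast
qed

text \<open>A chain map that is zero on the cokernels is homotopic to zero; the columns of \<open>\<delta> 0\<close>
represent the map on cokernels.\<close>

lemma null_homotopy:
  fixes D :: "nat \<Rightarrow> 'a::comm_ring_1 mat"
  assumes D: "\<And>i. D i \<in> carrier_mat (b i) (b (Suc i))"
    and D0: "\<And>i. D i * D (Suc i) = 0\<^sub>m (b i) (b (Suc (Suc i)))"
    and ex: "exact_seq b' D'"
    and \<delta>: "\<And>i. \<delta> i \<in> carrier_mat (b' i) (b i)"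
    and chain: "\<And>i. \<delta> i * D i = D' i * \<delta> (Suc i)"
    and start: "\<And>c. c < b 0 \<Longrightarrow> col (\<delta> 0) c \<in> (\<lambda>w. D' 0 *\<^sub>v w) ` carrier_vec (b' 1)"
  shows "\<exists>h. (\<forall>i. h i \<in> carrier_mat (b' (Suc i)) (b i)) \<and> \<delta> 0 = D' 0 * h 0 \<and>
    (\<forall>i. \<delta> (Suc i) = D' (Suc i) * h (Suc i) + h i * D i)"
proof -
  note D' = exact_seqD(1)[OF ex]
  let ?P = "\<lambda>i H. H \<in> carrier_mat (b' (Suc i)) (b i) \<and> (i = 0 \<longrightarrow> \<delta> 0 = D' 0 * H) \<and>
    D' i * (\<delta> (Suc i) - H * D i) = 0\<^sub>m (b' i) (b (Suc i))"
  let ?Q = "\<lambda>i H H'. \<delta> (Suc i) = D' (Suc i) * H' + H * D i"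
  have "\<exists>h. \<forall>i. ?P i (h i) \<and> ?Q i (h i) (h (Suc i))"
  proof (rule dependent_nat_choice)
    obtain H where H: "H \<in> carrier_mat (b' 1) (b 0)" "\<delta> 0 = D' 0 * H"
      using factor_through_columns[OF _ \<delta>[of 0] start] D'[of 0] by auto
    have "D' 0 * (\<delta> 1 - H * D 0) = D' 0 * \<delta> 1 - D' 0 * (H * D 0)"
      using D[of 0] D'[of 0] H(1) \<delta>[of 1] by (intro mult_minus_distrib_mat) auto
    also have "\<dots> = D' 0 * \<delta> 1 - \<delta> 0 * D 0"
      unfolding H(2) using assoc_mult_mat[of "D' 0" _ _ H _ "D 0"] D[of 0] D'[of 0] H(1) by simp
    also have "\<dots> = 0\<^sub>m (b' 0) (b 1)" using chain[of 0] \<delta>[of 1] D'[of 0] by auto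
    finally show "\<exists>H. ?P 0 H" using H by auto
  next
    fix H i assume P: "?P i H"
    then have H: "H \<in> carrier_mat (b' (Suc i)) (b i)" by simp
    note HD = mult_carrier_mat[OF H D]
    have z: "D' i * (\<delta> (Suc i) - H * D i) = 0\<^sub>m (b' i) (b (Suc i))" using P by simp
    obtain H' where H': "H' \<in> carrier_mat (b' (Suc (Suc i))) (b (Suc i))"
      "\<delta> (Suc i) - H * D i = D' (Suc i) * H'"
      using exact_factor[OF ex minus_carrier_mat[OF HD] z] by (elim bexE)
    note DH' = mult_carrier_mat[OF D' H'(1)]
    have Q: "\<delta> (Suc i) = D' (Suc i) * H' + H * D i"
      unfolding H'(2)[symmetric] using HD \<delta>[of "Suc i"] by (intro eq_matI) auto
    have "D' (Suc i) * (\<delta> (Suc (Suc i)) - H' * D (Suc i)) =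
        D' (Suc i) * \<delta> (Suc (Suc i)) - D' (Suc i) * (H' * D (Suc i))"
      by (rule mult_minus_distrib_mat[OF D' \<delta> mult_carrier_mat[OF H'(1) D]])
    also have "\<dots> = \<delta> (Suc i) * D (Suc i) - D' (Suc i) * H' * D (Suc i)"
      unfolding chain assoc_mult_mat[OF D' H'(1) D] ..
    also have "\<dots> = D' (Suc i) * H' * D (Suc i) + H * D i * D (Suc i) - D' (Suc i) * H' * D (Suc i)"
      unfolding Q using add_mult_distrib_mat[OF DH' HD D] by simp
    also have "H * D i * D (Suc i) = 0\<^sub>m (b' (Suc i)) (b (Suc (Suc i)))"
      unfolding assoc_mult_mat[OF H D D] D0 using H by simp
    finally have "D' (Suc i) * (\<delta> (Suc (Suc i)) - H' * D (Suc i)) = 0\<^sub>m (b' (Suc i)) (b (Suc (Suc i)))"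
      using mult_carrier_mat[OF DH' D] by simp
    then show "\<exists>H'. ?P (Suc i) H' \<and> ?Q i H H'" using H' Q by auto
  qed
  then show ?thesis by blast
qed

definition entries_in :: "'a set \<Rightarrow> 'a mat \<Rightarrow> bool" where
  "entries_in M A \<longleftrightarrow> (\<forall>r<dim_row A. \<forall>c<dim_col A. A $$ (r, c) \<in> M)"

lemma entries_in_mult:
  fixes A :: "'a::comm_ring_1 mat"
  assumes "A \<in> carrier_mat n m" "B \<in> carrier_mat m k" "entries_in (ideal_of T) A \<or> entries_in (ideal_of T) B"
  shows "entries_in (ideal_of T) (A * B)"
  using assms(3) unfolding entries_in_def
proof (elim disjE; intro allI impI)
  fix r c assume *: "\<forall>r<dim_row A. \<forall>c<dim_col A. A $$ (r, c) \<in> ideal_of T"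
    "r < dim_row (A * B)" "c < dim_col (A * B)"
  show "(A * B) $$ (r, c) \<in> ideal_of T"
    using * assms(1,2) by (auto simp: scalar_prod_def intro!: ideal_sum ideal_mult_right)
next
  fix r c assume *: "\<forall>r<dim_row B. \<forall>c<dim_col B. B $$ (r, c) \<in> ideal_of T"
    "r < dim_row (A * B)" "c < dim_col (A * B)"
  show "(A * B) $$ (r, c) \<in> ideal_of T"
    using * assms(1,2) by (auto simp: scalar_prod_def intro!: ideal_sum ideal_mult)
qed

text \<open>If the differentials have entries in an ideal, so has everything of the form \<open>D h + h D\<close>.
This serves twice: for the irrelevant ideal it gives uniqueness of minimal ranks, and for
the ideal of the \<open>Y c\<close> it identifies a constant entry of a comparison map.\<close>

lemma endomorphism_entries:
  fixes D :: "nat \<Rightarrow> 'a::comm_ring_1 mat"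
  assumes ex: "exact_seq b D"
    and M: "\<And>i. entries_in (ideal_of T) (D i)"
    and \<delta>: "\<And>i. \<delta> i \<in> carrier_mat (b i) (b i)"
    and chain: "\<And>i. \<delta> i * D i = D i * \<delta> (Suc i)"
    and start: "\<And>c. c < b 0 \<Longrightarrow> col (\<delta> 0) c \<in> (\<lambda>w. D 0 *\<^sub>v w) ` carrier_vec (b 1)"
  shows "entries_in (ideal_of T) (\<delta> i)"
proof -
  note D = exact_seqD(1)[OF ex]
  obtain h where h: "\<And>i. h i \<in> carrier_mat (b (Suc i)) (b i)" "\<delta> 0 = D 0 * h 0"
    "\<And>i. \<delta> (Suc i) = D (Suc i) * h (Suc i) + h i * D i"
    using null_homotopy[OF D exact_comp_zero[OF ex] ex \<delta> chain start] by blast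
  show ?thesis
  proof (cases i)
    case 0
    then show ?thesis using entries_in_mult[OF D h(1)] M h(2) by simp
  next
    case (Suc j)
    have "entries_in (ideal_of T) (D i * h i)" "entries_in (ideal_of T) (h j * D j)"
      using entries_in_mult[OF D h(1)] entries_in_mult[OF h(1) D] M by auto
    then show ?thesis
      using h(3)[of j] D[of i] D[of j] h(1)[of i] h(1)[of j]
      by (auto simp: entries_in_def Suc intro!: ideal_add)
  qed
qed

section \<open>Graded resolutions of cyclic modules\<close>

text \<open>A graded free resolution of \<open>R/I\<close> that starts with \<open>R\<close> in degree \<open>0\<close> and the canonical map
onto \<open>R/I\<close>.\<close>

definition cyclic_resolution ::
  "('v, 'k::field) mpoly set \<Rightarrow> (nat \<Rightarrow> nat) \<Rightarrow> (nat \<Rightarrow> nat \<Rightarrow> int) \<Rightarrow> (nat \<Rightarrow> ('v, 'k) mpoly mat) \<Rightarrow> bool" where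
  "cyclic_resolution I b s D \<longleftrightarrow>
     b 0 = 1 \<and> s 0 0 = 0 \<and> exact_seq b D \<and>
     (\<forall>v\<in>carrier_vec 1. v $ 0 \<in> I \<longleftrightarrow> v \<in> (\<lambda>w. D 0 *\<^sub>v w) ` carrier_vec (b 1)) \<and>
     (\<forall>i. \<forall>r<b i. \<forall>c<b (Suc i). homogeneous (s (Suc i) c - s i r) (D i $$ (r, c)))"

lemma cyclic_resolutionD:
  assumes "cyclic_resolution I b s D"
  shows "b 0 = 1" "s 0 0 = 0" "exact_seq b D"
    "v \<in> carrier_vec 1 \<Longrightarrow> v $ 0 \<in> I \<longleftrightarrow> v \<in> (\<lambda>w. D 0 *\<^sub>v w) ` carrier_vec (b 1)"
    "r < b i \<Longrightarrow> c < b (Suc i) \<Longrightarrow> homogeneous (s (Suc i) c - s i r) (D i $$ (r, c))"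
    "D i \<in> carrier_mat (b i) (b (Suc i))"
  using assms exact_seqD(1)[of b D] by (auto simp: cyclic_resolution_def)

lemma cyclic_resolution_col:
  assumes "cyclic_resolution I b s D" "c < b 1"
  shows "D 0 $$ (0, c) \<in> I"
proof -
  note D = cyclic_resolutionD[OF assms(1)]
  have "col (D 0) c = D 0 *\<^sub>v unit_vec (b 1) c"
    using D(6)[of 0] assms(2) by (intro eq_vecI) auto
  then have "col (D 0) c \<in> (\<lambda>w. D 0 *\<^sub>v w) ` carrier_vec (b 1)" by auto
  moreover have "col (D 0) c \<in> carrier_vec 1" using D(1) D(6)[of 0] by (intro carrier_vecI) auto
  ultimately have "col (D 0) c $ 0 \<in> I" using D(4) by blast
  then show ?thesis using D(1) D(6)[of 0] assms(2) by simp
qed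

text \<open>The degree-preserving part of a map between graded free modules with generators in degrees
\<open>t c\<close> and \<open>s r\<close>. Taking it commutes with composition with degree-preserving maps, so that a
chain map between graded resolutions can be replaced by a graded one.\<close>

definition degree_part ::
  "(nat \<Rightarrow> int) \<Rightarrow> (nat \<Rightarrow> int) \<Rightarrow> ('v, 'k::field) mpoly mat \<Rightarrow> ('v, 'k) mpoly mat" where
  "degree_part s t A = mat (dim_row A) (dim_col A) (\<lambda>(r, c). homogeneous_part (t c - s r) (A $$ (r, c)))"

lemma degree_part_carrier [simp]: "A \<in> carrier_mat m n \<Longrightarrow> degree_part s t A \<in> carrier_mat m n"
  by (auto simp: degree_part_def)

lemma degree_part_mult_right:
  assumes A: "A \<in> carrier_mat l m" and B: "B \<in> carrier_mat m n"
    and hom: "\<And>k c. k < m \<Longrightarrow> c < n \<Longrightarrow> homogeneous (u c - t k) (B $$ (k, c))"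
  shows "degree_part s t A * B = degree_part s u (A * B)"
proof (rule eq_matI)
  fix r c assume "r < dim_row (degree_part s u (A * B))" "c < dim_col (degree_part s u (A * B))"
  then have rc: "r < l" "c < n" using A B by (auto simp: degree_part_def)
  show "(degree_part s t A * B) $$ (r, c) = degree_part s u (A * B) $$ (r, c)"
    using rc A B by (auto simp: degree_part_def scalar_prod_def homogeneous_part_sum homogeneous_part_mult[OF hom] intro!: sum.cong)
qed (use A B in \<open>auto simp: degree_part_def\<close>)

lemma degree_part_mult_left:
  assumes A: "A \<in> carrier_mat l m" and B: "B \<in> carrier_mat m n"
    and hom: "\<And>r k. r < l \<Longrightarrow> k < m \<Longrightarrow> homogeneous (t k - s r) (A $$ (r, k))"
  shows "A * degree_part t u B = degree_part s u (A * B)"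
proof (rule eq_matI)
  fix r c assume "r < dim_row (degree_part s u (A * B))" "c < dim_col (degree_part s u (A * B))"
  then have rc: "r < l" "c < n" using A B by (auto simp: degree_part_def)
  have *: "A $$ (r, k) * homogeneous_part (u c - t k) (B $$ (k, c)) = homogeneous_part (u c - s r) (A $$ (r, k) * B $$ (k, c))"
    if "k < m" for k
    using homogeneous_part_mult[OF hom[OF rc(1) that], of "u c - s r" "B $$ (k, c)"] by (simp add: mult.commute)
  show "(A * degree_part t u B) $$ (r, c) = degree_part s u (A * B) $$ (r, c)"
    using rc A B by (auto simp: degree_part_def scalar_prod_def homogeneous_part_sum * intro!: sum.cong)
qed (use A B in \<open>auto simp: degree_part_def\<close>)

text \<open>If \<open>f Q \<subseteq> I\<close>, multiplication by \<open>f\<close> is a map from \<open>R/Q\<close> to \<open>R/I\<close> and extends to the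
resolutions; the degrees of the entries are those of a graded map out of the resolution of
\<open>R/Q\<close> shifted by \<open>d\<close>.\<close>

lemma graded_comparison:
  assumes A: "cyclic_resolution I b s D" and B: "cyclic_resolution Q b' s' D'"
    and f: "homogeneous d f" and fQ: "\<And>p. p \<in> Q \<Longrightarrow> f * p \<in> I"
  obtains \<alpha> where "\<And>i. \<alpha> i \<in> carrier_mat (b i) (b' i)" "\<alpha> 0 $$ (0, 0) = f"
    "\<And>i. \<alpha> i * D' i = D i * \<alpha> (Suc i)"
    "\<And>i r c. r < b i \<Longrightarrow> c < b' i \<Longrightarrow> homogeneous (s' i c + d - s i r) (\<alpha> i $$ (r, c))"
proof -
  note colB = cyclic_resolution_col[OF B]
  note A = cyclic_resolutionD[OF A] and B = cyclic_resolutionD[OF B]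
  let ?f = "mat 1 1 (\<lambda>_. f)"
  have "col (?f * D' 0) c \<in> (\<lambda>w. D 0 *\<^sub>v w) ` carrier_vec (b 1)" if c: "c < b' 1" for c
  proof -
    have "col (?f * D' 0) c $ 0 = f * D' 0 $$ (0, c)"
      using B(1) B(6)[of 0] c by (simp add: scalar_prod_def)
    then show ?thesis
      using fQ[OF colB[OF c]] A(4)[of "col (?f * D' 0) c"] B(6)[of 0] c
      by (metis carrier_vecI dim_col dim_row_mat(1) index_mult_mat(2))
  qed
  then obtain \<beta> where \<beta>: "\<beta> 0 = ?f" "\<And>i. \<beta> i \<in> carrier_mat (b i) (b' i)"
    "\<And>i. \<beta> i * D' i = D i * \<beta> (Suc i)"
    using chain_map_extension[of D' b' b D ?f, OF B(6) exact_comp_zero[OF B(3)] A(3)] A(1) B(1) by auto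
  \<comment> \<open>The extension \<open>\<beta>\<close> need not be graded.\<close>
  define \<alpha> where "\<alpha> i = degree_part (s i) (\<lambda>c. s' i c + d) (\<beta> i)" for i
  show ?thesis
  proof (rule that[of \<alpha>])
    show "\<alpha> i \<in> carrier_mat (b i) (b' i)" for i using \<beta>(2) by (simp add: \<alpha>_def)
    show "\<alpha> 0 $$ (0, 0) = f"
      unfolding \<alpha>_def \<beta>(1) by (simp add: degree_part_def A(2) B(2) homogeneous_part_homogeneous[OF f])
    show "\<alpha> i * D' i = D i * \<alpha> (Suc i)" for i
      unfolding \<alpha>_def
      by (subst degree_part_mult_right[OF \<beta>(2) B(6), where u = "\<lambda>c. s' (Suc i) c + d"],
          use B(5) in simp, subst degree_part_mult_left[OF A(6) \<beta>(2) A(5)], auto simp: \<beta>(3))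
    show "homogeneous (s' i c + d - s i r) (\<alpha> i $$ (r, c))" if "r < b i" "c < b' i" for i r c
      using \<beta>(2)[of i] that by (simp add: \<alpha>_def degree_part_def homogeneous_homogeneous_part)
  qed
qed

section \<open>Mapping cones\<close>

text \<open>The cone of a chain map \<open>\<alpha>\<close> from \<open>F'\<close> to \<open>F\<close> has \<open>F i\<close> plus \<open>F' (i - 1)\<close> in homological
degree \<open>i\<close>, with \<open>F' (-1)\<close> being zero.\<close>

definition cone_rank :: "(nat \<Rightarrow> nat) \<Rightarrow> (nat \<Rightarrow> nat) \<Rightarrow> nat \<Rightarrow> nat" where
  "cone_rank b b' i = b i + case_nat 0 b' i"

lemma cone_rank_cases:
  assumes "r < cone_rank b b' i"
  obtains "r < b i" | j where "\<not> r < b i" "i = Suc j" "r - b i < b' j"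
  using assms by (cases i; cases "r < b i") (auto simp: cone_rank_def)

definition cone_shift :: "(nat \<Rightarrow> nat) \<Rightarrow> (nat \<Rightarrow> nat \<Rightarrow> int) \<Rightarrow> (nat \<Rightarrow> nat \<Rightarrow> int) \<Rightarrow> int \<Rightarrow> nat \<Rightarrow> nat \<Rightarrow> int" where
  "cone_shift b s s' d i c = (if c < b i then s i c else s' (i - 1) (c - b i) + d)"

text \<open>The block matrix with rows \<open>D i, \<alpha> i\<close> and \<open>0, - D' (i - 1)\<close>. For \<open>i = 0\<close> the lower blocks
have no rows, which keeps the differential into \<open>F 0\<close> inside the general pattern.\<close>

definition cone_diff :: "(nat \<Rightarrow> 'a::comm_ring_1 mat) \<Rightarrow> (nat \<Rightarrow> 'a mat) \<Rightarrow> (nat \<Rightarrow> 'a mat) \<Rightarrow> nat \<Rightarrow> 'a mat" where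
  "cone_diff D D' \<alpha> i =
    (let E = case_nat (0\<^sub>m 0 (dim_row (D' 0))) D' i
     in four_block_mat (D i) (\<alpha> i) (0\<^sub>m (dim_row E) (dim_col (D i))) (- E))"

lemma case_nat_carrier:
  assumes "\<And>i. D' i \<in> carrier_mat (b' i) (b' (Suc i))"
  shows "case_nat (0\<^sub>m 0 (dim_row (D' 0))) D' i \<in> carrier_mat (case_nat 0 b' i) (b' i)"
proof (cases i)
  case 0
  then show ?thesis using carrier_matD(1)[OF assms[of 0]] by simp
qed (simp add: assms)

lemma cone_diff_index:
  assumes D: "D i \<in> carrier_mat (b i) (b (Suc i))"
    and D': "\<And>i. D' i \<in> carrier_mat (b' i) (b' (Suc i))"
    and \<alpha>: "\<alpha> i \<in> carrier_mat (b i) (b' i)"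
  shows "cone_diff D D' \<alpha> i \<in> carrier_mat (cone_rank b b' i) (cone_rank b b' (Suc i))"
    and "r < cone_rank b b' i \<Longrightarrow> c < cone_rank b b' (Suc i) \<Longrightarrow> cone_diff D D' \<alpha> i $$ (r, c) =
      (if r < b i then if c < b (Suc i) then D i $$ (r, c) else \<alpha> i $$ (r, c - b (Suc i))
       else if c < b (Suc i) then 0 else - D' (i - 1) $$ (r - b i, c - b (Suc i)))"
  using D D'[of "i - 1"] D'[of i] \<alpha> case_nat_carrier[of D' b' i, OF D']
  by (auto simp: cone_diff_def cone_rank_def Let_def split: nat.split_asm)

text \<open>If \<open>Q = (S) : f\<close>, then multiplication by \<open>f\<close> gives an exact sequence
\<open>0 \<rightarrow> R/Q \<rightarrow> R/(S) \<rightarrow> R/(S, f) \<rightarrow> 0\<close>.\<close>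

lemma cone_exact:
  assumes A: "cyclic_resolution (ideal_of S) b s D" and B: "cyclic_resolution Q b' s' D'"
    and Q: "\<And>p. p \<in> Q \<longleftrightarrow> f * p \<in> ideal_of S"
    and \<alpha>: "\<And>i. \<alpha> i \<in> carrier_mat (b i) (b' i)" "\<alpha> 0 $$ (0, 0) = f"
      "\<And>i. \<alpha> i * D' i = D i * \<alpha> (Suc i)"
  shows "exact_seq (cone_rank b b') (cone_diff D D' \<alpha>)"
    and "v \<in> carrier_vec 1 \<Longrightarrow> v $ 0 \<in> ideal_of (insert f S) \<longleftrightarrow>
      v \<in> (\<lambda>w. cone_diff D D' \<alpha> 0 *\<^sub>v w) ` carrier_vec (cone_rank b b' 1)"
proof -
  note A = cyclic_resolutionD[OF A] and B = cyclic_resolutionD[OF B]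
  let ?F = "cone_diff D D' \<alpha>" and ?b = "cone_rank b b'"
  define E where "E = case_nat (0\<^sub>m 0 (dim_row (D' 0))) D'"
  have E: "E i \<in> carrier_mat (case_nat 0 b' i) (b' i)" for i
    unfolding E_def by (rule case_nat_carrier[of D' b', OF B(6)])
  have cone_vec: "?F i *\<^sub>v (v @\<^sub>v w) = (D i *\<^sub>v v + \<alpha> i *\<^sub>v w) @\<^sub>v (- (E i *\<^sub>v w))"
    if "v \<in> carrier_vec (b (Suc i))" "w \<in> carrier_vec (b' i)" for i v w
  proof -
    have "?F i *\<^sub>v (v @\<^sub>v w) = (D i *\<^sub>v v + \<alpha> i *\<^sub>v w) @\<^sub>v (0\<^sub>m (case_nat 0 b' i) (b (Suc i)) *\<^sub>v v + - E i *\<^sub>v w)"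
      using E[of i] A(6)[of i] four_block_mat_mult_vec[OF A(6) \<alpha>(1) zero_carrier_mat[of "case_nat 0 b' i"] _ that, of "- E i"] that
      by (simp add: cone_diff_def E_def[symmetric] Let_def)
    moreover have "0\<^sub>m (case_nat 0 b' i) (b (Suc i)) *\<^sub>v v + - E i *\<^sub>v w = - (E i *\<^sub>v w)"
      using E[of i] that by (intro eq_vecI) auto
    ultimately show ?thesis by simp
  qed
  have zero_app: "0\<^sub>v m @\<^sub>v 0\<^sub>v n = (0\<^sub>v (m + n) :: ('a, 'b) mpoly vec)" for m n
    by (intro eq_vecI) auto
  have split: "\<exists>v w. v \<in> carrier_vec (b (Suc i)) \<and> w \<in> carrier_vec (b' i) \<and> x = v @\<^sub>v w"
    if "x \<in> carrier_vec (?b (Suc i))" for x i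
    using that vec_first_last_append[of x "b (Suc i)" "b' i"] by (metis cone_rank_def nat.case(2) vec_first_carrier vec_last_carrier)
  have F: "?F i \<in> carrier_mat (?b i) (?b (Suc i))" for i
    by (rule cone_diff_index(1)[of D i b D' b' \<alpha>, OF A(6) B(6) \<alpha>(1)])
  have \<alpha>0: "(\<alpha> 0 *\<^sub>v w) $ 0 = f * w $ 0" "\<alpha> 0 *\<^sub>v w \<in> carrier_vec 1" if "w \<in> carrier_vec 1" for w
    using \<alpha>(1)[of 0] \<alpha>(2) A(1) B(1) that by (auto simp: scalar_prod_def)
  have dim_\<alpha>0: "dim_row (\<alpha> 0) = 1" using carrier_matD(1)[OF \<alpha>(1)[of 0]] A(1) by simp
  have chain: "\<alpha> i *\<^sub>v (D' i *\<^sub>v u) = D i *\<^sub>v (\<alpha> (Suc i) *\<^sub>v u)" if "u \<in> carrier_vec (b' (Suc i))" for i u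
    using assoc_mult_mat_vec[OF \<alpha>(1) B(6) that] assoc_mult_mat_vec[OF A(6) \<alpha>(1) that] \<alpha>(3) by simp
  have kerD: "D i *\<^sub>v (D (Suc i) *\<^sub>v u) = 0\<^sub>v (b i)" if "u \<in> carrier_vec (b (Suc (Suc i)))" for i u
    using mat_kernelD(2)[OF A(6), of _ i] exact_seqD(2)[OF A(3), of i] that by blast
  \<comment> \<open>The second component of a cycle is a boundary: for \<open>i > 0\<close> by exactness, and for \<open>i = 0\<close> because \<open>f w\<close> is in \<open>(S)\<close>, which puts \<open>w\<close> into \<open>Q\<close>.\<close>
  have kerE: "w \<in> (\<lambda>u. D' i *\<^sub>v u) ` carrier_vec (b' (Suc i))"
    if v: "v \<in> carrier_vec (b (Suc i))" and w: "w \<in> carrier_vec (b' i)"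
      and Dv: "D i *\<^sub>v v + \<alpha> i *\<^sub>v w = 0\<^sub>v (b i)" and Ew: "E i *\<^sub>v w = 0\<^sub>v (case_nat 0 b' i)" for i v w
  proof (cases i)
    case 0
    have "\<alpha> 0 *\<^sub>v w = D 0 *\<^sub>v (- v)"
    proof (rule eq_vecI)
      fix j assume "j < dim_vec (D 0 *\<^sub>v - v)"
      then have j: "j < b 0" using A(6)[of 0] by simp
      have "(D 0 *\<^sub>v v + \<alpha> 0 *\<^sub>v w) $ j = 0" using Dv j by (simp add: 0)
      then have "(\<alpha> 0 *\<^sub>v w) $ j = - (D 0 *\<^sub>v v) $ j"
        using j \<alpha>(1)[of 0] by (simp add: eq_neg_iff_add_eq_0 add.commute)
      also have "\<dots> = (D 0 *\<^sub>v (- v)) $ j"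
        using j A(6)[of 0] v by (simp add: 0)
      finally show "(\<alpha> 0 *\<^sub>v w) $ j = (D 0 *\<^sub>v - v) $ j" .
    qed (use A(6)[of 0] \<alpha>(1)[of 0] in auto)
    then have "f * w $ 0 \<in> ideal_of S"
      using A(4)[of "\<alpha> 0 *\<^sub>v w"] \<alpha>0[of w] v w B(1) by (auto simp: 0)
    then show ?thesis using Q B(4)[of w] w B(1) by (simp add: 0)
  next
    case (Suc j)
    have "w \<in> mat_kernel (D' j)"
      using Ew w by (intro mat_kernelI[OF B(6)]) (simp_all add: Suc E_def)
    then show ?thesis using exact_seqD(2)[OF B(3), of j] by (simp add: Suc)
  qed
  show "exact_seq ?b ?F"
    unfolding exact_seq_def
  proof (intro conjI allI F)
    fix i
    show "mat_kernel (?F i) = (\<lambda>w. ?F (Suc i) *\<^sub>v w) ` carrier_vec (?b (Suc (Suc i)))"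
    proof (intro subset_antisym subsetI)
      fix x assume "x \<in> mat_kernel (?F i)"
      from mat_kernelD[OF F this] have x: "x \<in> carrier_vec (?b (Suc i))" "?F i *\<^sub>v x = 0\<^sub>v (?b i)" by auto
      obtain v w where vw: "v \<in> carrier_vec (b (Suc i))" "w \<in> carrier_vec (b' i)" "x = v @\<^sub>v w"
        using split[OF x(1)] by blast
      have "(D i *\<^sub>v v + \<alpha> i *\<^sub>v w) @\<^sub>v (- (E i *\<^sub>v w)) = 0\<^sub>v (b i) @\<^sub>v 0\<^sub>v (case_nat 0 b' i)"
        using x(2) unfolding vw(3) cone_vec[OF vw(1,2)] by (simp add: cone_rank_def zero_app)
      then have *: "D i *\<^sub>v v + \<alpha> i *\<^sub>v w = 0\<^sub>v (b i)" "- (E i *\<^sub>v w) = 0\<^sub>v (case_nat 0 b' i)"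
        using append_vec_eq[of "D i *\<^sub>v v + \<alpha> i *\<^sub>v w" "b i" "0\<^sub>v (b i)"] A(6)[of i] \<alpha>(1)[of i] vw(1,2) by auto
      have "E i *\<^sub>v w = 0\<^sub>v (case_nat 0 b' i)"
      proof (rule eq_vecI)
        fix j assume "j < dim_vec (0\<^sub>v (case_nat 0 b' i) :: ('a, 'b) mpoly vec)"
        then have "(- (E i *\<^sub>v w)) $ j = 0" "j < dim_vec (E i *\<^sub>v w)" using *(2) E[of i] by auto
        then show "(E i *\<^sub>v w) $ j = 0\<^sub>v (case_nat 0 b' i) $ j" using E[of i] by auto
      qed (use E[of i] in auto)
      from kerE[OF vw(1,2) *(1) this] obtain u where u: "u \<in> carrier_vec (b' (Suc i))" "w = D' i *\<^sub>v u" by auto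
      \<comment> \<open>Subtracting the boundary of \<open>(0, - u)\<close> leaves a cycle in the first component.\<close>
      have "D i *\<^sub>v (v + \<alpha> (Suc i) *\<^sub>v u) = 0\<^sub>v (b i)"
        using *(1) mult_add_distrib_mat_vec[OF A(6) vw(1), of "\<alpha> (Suc i) *\<^sub>v u"] u chain[OF u(1)] \<alpha>(1)[of "Suc i"] by auto
      then have "v + \<alpha> (Suc i) *\<^sub>v u \<in> mat_kernel (D i)"
        using vw(1) \<alpha>(1)[of "Suc i"] u by (intro mat_kernelI[OF A(6)]) auto
      then obtain z where z: "z \<in> carrier_vec (b (Suc (Suc i)))" "v + \<alpha> (Suc i) *\<^sub>v u = D (Suc i) *\<^sub>v z"
        unfolding exact_seqD(2)[OF A(3)] by auto
      have "v = D (Suc i) *\<^sub>v z + \<alpha> (Suc i) *\<^sub>v (- u)"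
        unfolding z(2)[symmetric]
        using vw(1) \<alpha>(1)[of "Suc i"] u(1) by (intro eq_vecI) auto
      moreover have "w = - (E (Suc i) *\<^sub>v (- u))"
        using u B(6)[of i] by (intro eq_vecI) (auto simp: E_def)
      ultimately have "x = ?F (Suc i) *\<^sub>v (z @\<^sub>v (- u))"
        unfolding vw(3) using cone_vec[of z "Suc i" "- u"] z(1) u(1) by simp
      moreover have "z @\<^sub>v (- u) \<in> carrier_vec (?b (Suc (Suc i)))"
        using z(1) u(1) by (simp add: cone_rank_def)
      ultimately show "x \<in> (\<lambda>w. ?F (Suc i) *\<^sub>v w) ` carrier_vec (?b (Suc (Suc i)))" by blast
    next
      fix x assume "x \<in> (\<lambda>w. ?F (Suc i) *\<^sub>v w) ` carrier_vec (?b (Suc (Suc i)))"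
      then obtain y where y: "y \<in> carrier_vec (?b (Suc (Suc i)))" "x = ?F (Suc i) *\<^sub>v y" by blast
      obtain z u where zu: "z \<in> carrier_vec (b (Suc (Suc i)))" "u \<in> carrier_vec (b' (Suc i))" "y = z @\<^sub>v u"
        using split[OF y(1)] by blast
      let ?v = "D (Suc i) *\<^sub>v z + \<alpha> (Suc i) *\<^sub>v u" and ?w = "- (D' i *\<^sub>v u)"
      have x: "x = ?v @\<^sub>v ?w" unfolding y zu(3) cone_vec[OF zu(1,2)] by (simp add: E_def)
      have c: "D (Suc i) *\<^sub>v z \<in> carrier_vec (b (Suc i))" "\<alpha> (Suc i) *\<^sub>v u \<in> carrier_vec (b (Suc i))"
        "D' i *\<^sub>v u \<in> carrier_vec (b' i)"
        using A(6)[of "Suc i"] \<alpha>(1)[of "Suc i"] B(6)[of i] zu by auto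
      have 1: "D i *\<^sub>v ?v + \<alpha> i *\<^sub>v ?w = 0\<^sub>v (b i)"
      proof (rule eq_vecI)
        fix j assume "j < dim_vec (0\<^sub>v (b i) :: ('a, 'b) mpoly vec)"
        then have j: "j < b i" by simp
        have "(D i *\<^sub>v ?v) $ j = (D i *\<^sub>v (\<alpha> (Suc i) *\<^sub>v u)) $ j"
          unfolding mult_add_distrib_mat_vec[OF A(6) c(1,2)] kerD[OF zu(1)] using j A(6)[of i] c by simp
        also have "\<dots> = (\<alpha> i *\<^sub>v (D' i *\<^sub>v u)) $ j" unfolding chain[OF zu(2)] ..
        finally show "(D i *\<^sub>v ?v + \<alpha> i *\<^sub>v ?w) $ j = 0\<^sub>v (b i) $ j"
          using j A(6)[of i] B(6)[of i] \<alpha>(1)[of i] c by simp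
      qed (use A(6)[of i] \<alpha>(1)[of i] in auto)
      have 2: "- (E i *\<^sub>v ?w) = 0\<^sub>v (case_nat 0 b' i)"
      proof (cases i)
        case 0
        then show ?thesis using E[of 0] by (intro eq_vecI) auto
      next
        case (Suc k)
        have "D' i *\<^sub>v u \<in> mat_kernel (D' k)"
          unfolding exact_seqD(2)[OF B(3)] using zu(2) by (auto simp: Suc)
        then have "D' k *\<^sub>v (D' i *\<^sub>v u) = 0\<^sub>v (b' k)" by (rule mat_kernelD(2)[OF B(6)])
        moreover have "D' k *\<^sub>v ?w = - (D' k *\<^sub>v (D' i *\<^sub>v u))"
          using c(3) B(6)[of k] B(6)[of i] by (intro eq_vecI) (auto simp: Suc)
        ultimately have "D' k *\<^sub>v ?w = 0\<^sub>v (b' k)" by simp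
        then show ?thesis by (intro eq_vecI) (auto simp: Suc E_def)
      qed
      have "?F i *\<^sub>v x = 0\<^sub>v (?b i)"
        unfolding x using cone_vec[of ?v i ?w] c 1 2 by (simp add: cone_rank_def zero_app)
      moreover have "x \<in> carrier_vec (?b (Suc i))" unfolding x using c by (auto simp: cone_rank_def)
      ultimately show "x \<in> mat_kernel (?F i)" by (intro mat_kernelI[OF F])
    qed
  qed
  assume v: "v \<in> carrier_vec 1"
  have E0: "(x :: ('a, 'b) mpoly vec) @\<^sub>v - (E 0 *\<^sub>v w) = x" for x w
    using E[of 0] by (intro eq_vecI) auto
  show "v $ 0 \<in> ideal_of (insert f S) \<longleftrightarrow> v \<in> (\<lambda>w. ?F 0 *\<^sub>v w) ` carrier_vec (?b 1)"
  proof
    assume "v $ 0 \<in> ideal_of (insert f S)"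
    then obtain k where k: "v $ 0 - k * f \<in> ideal_of S" unfolding ideal_insert_iff by blast
    let ?w = "vec 1 (\<lambda>_. k)"
    have w: "?w \<in> carrier_vec 1" by simp
    have "(v - \<alpha> 0 *\<^sub>v ?w) $ 0 = v $ 0 - (\<alpha> 0 *\<^sub>v ?w) $ 0"
      by (rule index_minus_vec(1)) (unfold dim_mult_mat_vec dim_\<alpha>0, simp)
    also have "\<dots> = v $ 0 - k * f" unfolding \<alpha>0(1)[OF w] by simp
    finally have "(v - \<alpha> 0 *\<^sub>v ?w) $ 0 \<in> ideal_of S" using k by simp
    then obtain u where u: "u \<in> carrier_vec (b 1)" "v - \<alpha> 0 *\<^sub>v ?w = D 0 *\<^sub>v u"
      using A(4)[OF minus_carrier_vec[OF v \<alpha>0(2)[OF w]]] by blast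
    have "v = D 0 *\<^sub>v u + \<alpha> 0 *\<^sub>v ?w"
      unfolding u(2)[symmetric] using v \<alpha>0[OF w] by (intro eq_vecI) (auto simp: dim_\<alpha>0)
    then have "v = ?F 0 *\<^sub>v (u @\<^sub>v ?w)"
      using cone_vec[of u 0 ?w] u(1) B(1) by (simp add: E0)
    moreover have "u @\<^sub>v ?w \<in> carrier_vec (?b 1)"
      using append_carrier_vec[OF u(1) w] B(1) by (simp add: cone_rank_def)
    ultimately show "v \<in> (\<lambda>w. ?F 0 *\<^sub>v w) ` carrier_vec (?b 1)" by blast
  next
    assume "v \<in> (\<lambda>w. ?F 0 *\<^sub>v w) ` carrier_vec (?b 1)"
    then obtain x where x: "x \<in> carrier_vec (?b 1)" "v = ?F 0 *\<^sub>v x" by blast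
    obtain u w where uw: "u \<in> carrier_vec (b 1)" "w \<in> carrier_vec (b' 0)" "x = u @\<^sub>v w"
      using split[of x 0] x(1) by auto
    have v': "v = D 0 *\<^sub>v u + \<alpha> 0 *\<^sub>v w"
      unfolding x uw(3) using cone_vec[of u 0 w] uw by (simp add: E0)
    have Du: "D 0 *\<^sub>v u \<in> carrier_vec 1" using A(1) A(6)[of 0] by (intro carrier_vecI) auto
    then have "(D 0 *\<^sub>v u) $ 0 \<in> ideal_of S" using A(4)[OF Du] uw(1) by auto
    moreover have "v $ 0 = (D 0 *\<^sub>v u) $ 0 + w $ 0 * f"
      unfolding v' using index_add_vec(1)[of 0 "\<alpha> 0 *\<^sub>v w" "D 0 *\<^sub>v u"] \<alpha>0(1)[of w] uw(2) B(1)
      by (simp add: dim_\<alpha>0 mult.commute del: index_mult_mat_vec index_add_vec(1))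
    ultimately show "v $ 0 \<in> ideal_of (insert f S)"
      unfolding ideal_insert_iff by (intro exI[of _ "w $ 0"]) simp
  qed
qed


lemma cone_resolution:
  assumes A: "cyclic_resolution (ideal_of S) b s D" and B: "cyclic_resolution Q b' s' D'"
    and Q: "\<And>p. p \<in> Q \<longleftrightarrow> f * p \<in> ideal_of S"
    and \<alpha>: "\<And>i. \<alpha> i \<in> carrier_mat (b i) (b' i)" "\<alpha> 0 $$ (0, 0) = f"
      "\<And>i. \<alpha> i * D' i = D i * \<alpha> (Suc i)"
    and hom: "\<And>i r c. r < b i \<Longrightarrow> c < b' i \<Longrightarrow> homogeneous (s' i c + d - s i r) (\<alpha> i $$ (r, c))"
  shows "cyclic_resolution (ideal_of (insert f S)) (cone_rank b b') (cone_shift b s s' d) (cone_diff D D' \<alpha>)"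
proof -
  note exact = cone_exact[OF A B Q \<alpha>]
  note A = cyclic_resolutionD[OF A] and B = cyclic_resolutionD[OF B]
  note idx = cone_diff_index[of D _ b D' b' \<alpha>, OF A(6) B(6) \<alpha>(1)]
  have "homogeneous (cone_shift b s s' d (Suc i) c - cone_shift b s s' d i r) (cone_diff D D' \<alpha> i $$ (r, c))"
    if rc: "r < cone_rank b b' i" "c < cone_rank b b' (Suc i)" for i r c
  proof -
    have c: "c - b (Suc i) < b' i" if "\<not> c < b (Suc i)" using rc(2) that by (auto simp: cone_rank_def)
    consider "r < b i" | j where "\<not> r < b i" "i = Suc j" "r - b i < b' j"
      using cone_rank_cases[OF rc(1)] by metis
    then show ?thesis
    proof cases
      case 1
      then show ?thesis
        unfolding idx(2)[OF rc] using A(5)[of r i c] hom[OF 1 c] by (auto simp: cone_shift_def)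
    next
      case 2
      then show ?thesis
        unfolding idx(2)[OF rc] using homogeneous_uminus[OF B(5)[OF 2(3), of "c - b (Suc i)"]] c
        using B(6)[of j]
        by (auto simp: cone_shift_def homogeneous_0)
    qed
  qed
  then show ?thesis
    unfolding cyclic_resolution_def using exact A(1,2) by (simp add: cone_rank_def cone_shift_def)
qed

lemma cone_entries:
  assumes D: "\<And>i. D i \<in> carrier_mat (b i) (b (Suc i))"
    and D': "\<And>i. D' i \<in> carrier_mat (b' i) (b' (Suc i))"
    and \<alpha>: "\<And>i. \<alpha> i \<in> carrier_mat (b i) (b' i)"
    and M: "entries_in (ideal_of T) (D i)" "\<And>i. entries_in (ideal_of T) (D' i)" "entries_in (ideal_of T) (\<alpha> i)"
  shows "entries_in (ideal_of T) (cone_diff D D' \<alpha> i)"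
proof -
  note idx = cone_diff_index[of D _ b D' b' \<alpha>, OF D D' \<alpha>]
  have "cone_diff D D' \<alpha> i $$ (r, c) \<in> ideal_of T"
    if rc: "r < cone_rank b b' i" "c < cone_rank b b' (Suc i)" for r c
  proof -
    have c: "c - b (Suc i) < b' i" if "\<not> c < b (Suc i)" using rc(2) that by (auto simp: cone_rank_def)
    consider "r < b i" | j where "\<not> r < b i" "i = Suc j" "r - b i < b' j"
      using cone_rank_cases[OF rc(1)] by metis
    then show ?thesis
    proof cases
      case 1
      then show ?thesis
        unfolding idx(2)[OF rc] using M(1,3) c D[of i] \<alpha>[of i] by (auto simp: entries_in_def)
    next
      case 2
      then show ?thesis
        unfolding idx(2)[OF rc] using M(2)[of j] c D'[of j]
        by (auto simp: entries_in_def ideal_zero intro: ideal_uminus)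
    qed
  qed
  then show ?thesis using idx(1)[of i] by (auto simp: entries_in_def)
qed

section \<open>The Koszul complex\<close>

lemma cone_rank_choose:
  "cone_rank (\<lambda>i. n choose i) (\<lambda>i. n choose i) = (\<lambda>i. Suc n choose i)"
  by (rule ext) (simp add: cone_rank_def choose_reduce_nat split: nat.split)

text \<open>The Koszul complex as an iterated cone: for a regular sequence, the colon ideal of the next
element \<open>f\<close> is the ideal itself, and multiplication by \<open>f\<close> lifts to \<open>f\<close> times the identity.
Using this lift, instead of one given by the comparison theorem, keeps all entries in any
ideal that contains the sequence.\<close>

theorem koszul_resolution:
  fixes fs :: "('v, 'k::field) mpoly list"
  assumes "regular fs" "\<And>f. f \<in> set fs \<Longrightarrow> homogeneous d f" "\<And>f. f \<in> set fs \<Longrightarrow> f \<in> ideal_of T"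
  shows "\<exists>s D. cyclic_resolution (ideal_of (set fs)) (\<lambda>i. length fs choose i) s D \<and>
    (\<forall>i. \<forall>c<length fs choose i. s i c = int i * d) \<and> (\<forall>i. entries_in (ideal_of T) (D i))"
  using assms
proof (induct fs)
    case Nil
    define b where "b i = (if i = 0 then 1 else 0 :: nat)" for i :: nat
    have b: "(\<lambda>i. length [] choose i) = b" "b (Suc i) = 0" "b 0 = 1" for i
      by (auto simp: b_def fun_eq_iff binomial_eq_0)
    define D where "D i = (0\<^sub>m (b i) 0 :: ('v, 'k) mpoly mat)" for i
    have D: "D i \<in> carrier_mat (b i) 0" for i by (simp add: D_def)
    have "exact_seq b D"
      unfolding exact_seq_def b(2) using D trivial_kernel[OF D D[of "Suc _", unfolded b(2)]] by blast
    moreover have "v $ 0 \<in> {0} \<longleftrightarrow> v \<in> (\<lambda>w. D 0 *\<^sub>v w) ` carrier_vec 0" if "v \<in> carrier_vec 1" for v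
    proof -
      have "D 0 *\<^sub>v 0\<^sub>v 0 = 0\<^sub>v 1" by (intro eq_vecI) (auto simp: D_def b(3) scalar_prod_def)
      moreover have "v $ 0 = 0 \<longleftrightarrow> v = 0\<^sub>v 1" using that by (auto intro!: eq_vecI)
      ultimately show ?thesis unfolding carrier_vec_0 by simp
    qed
    ultimately have "cyclic_resolution (ideal_of (set [])) b (\<lambda>i _. int i * d) D"
      unfolding cyclic_resolution_def by (simp add: b ideal_empty)
    moreover have "entries_in (ideal_of T) (D i)" for i by (simp add: D_def entries_in_def)
    ultimately show ?case unfolding b(1) by blast
  next
    case (Cons f fs)
    let ?b = "\<lambda>i. length fs choose i"
    obtain s D where A: "cyclic_resolution (ideal_of (set fs)) ?b s D"
      and s: "\<forall>i. \<forall>c<?b i. s i c = int i * d" and M: "\<forall>i. entries_in (ideal_of T) (D i)"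
      using Cons by auto
    note D = cyclic_resolutionD(6)[OF A]
    define \<alpha> where "\<alpha> i = f \<cdot>\<^sub>m 1\<^sub>m (?b i)" for i
    have \<alpha>: "\<alpha> i \<in> carrier_mat (?b i) (?b i)" for i by (simp add: \<alpha>_def)
    have chain: "\<alpha> i * D i = D i * \<alpha> (Suc i)" for i
      using mult_smult_assoc_mat[OF one_carrier_mat D, of f i] mult_smult_distrib[OF D one_carrier_mat, of i f] D[of i]
      by (simp add: \<alpha>_def)
    have "cyclic_resolution (ideal_of (insert f (set fs))) (cone_rank ?b ?b) (cone_shift ?b s s d) (cone_diff D D \<alpha>)"
    proof (rule cone_resolution[OF A A _ \<alpha> _ chain])
      show "p \<in> ideal_of (set fs) \<longleftrightarrow> f * p \<in> ideal_of (set fs)" for p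
        using Cons(2) ideal_mult[of p "set fs" f] by (auto simp: mult.commute[of f])
      show "\<alpha> 0 $$ (0, 0) = f" by (simp add: \<alpha>_def)
      show "homogeneous (s i c + d - s i r) (\<alpha> i $$ (r, c))" if "r < ?b i" "c < ?b i" for i r c
        using that s Cons(3) by (auto simp: \<alpha>_def homogeneous_0)
    qed
    then have "cyclic_resolution (ideal_of (set (f # fs))) (\<lambda>i. length (f # fs) choose i) (cone_shift ?b s s d) (cone_diff D D \<alpha>)"
      by (simp add: cone_rank_choose)
    moreover have "cone_shift ?b s s d i c = int i * d" if "c < length (f # fs) choose i" for i c
    proof (cases "c < ?b i")
      case False
      have "c < cone_rank ?b ?b i" using that by (simp only: cone_rank_choose length_Cons)
      then obtain j where j: "i = Suc j" "c - ?b i < ?b j"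
        by (rule cone_rank_cases) (use False in blast)+
      then show ?thesis using s False by (simp add: cone_shift_def algebra_simps)
    qed (simp add: cone_shift_def s)
    moreover have "entries_in (ideal_of T) (cone_diff D D \<alpha> i)" for i
      by (rule cone_entries[of D ?b D ?b \<alpha>, OF D D \<alpha>])
        (use M Cons(4) in \<open>auto simp: \<alpha>_def entries_in_def ideal_zero\<close>)
    ultimately show ?case by blast
qed

section \<open>Cancelling a unit\<close>

text \<open>A resolution of length \<open>m + 2\<close> ends in a map from \<open>R\<close> to \<open>F (m + 1)\<close>. If its first
coordinate is a unit, its image is a complement of the span of the other basis vectors,
which may therefore replace \<open>F (m + 1)\<close>.\<close>

lemma cancel_unit:
  assumes A: "cyclic_resolution I b s D"
    and b: "b (Suc m) = Suc p" "b (Suc (Suc m)) = 1" "b (Suc (Suc (Suc m))) = 0"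
    and unit: "D (Suc m) $$ (0, 0) dvd 1"
    and entries: "\<And>i. i \<noteq> Suc m \<Longrightarrow> entries_in M (D i)"
  obtains D' where "cyclic_resolution I (b(Suc m := p, Suc (Suc m) := 0)) (s(Suc m := \<lambda>c. s (Suc m) (Suc c))) D'"
    and "\<And>i. entries_in M (D' i)"
proof -
  note A = cyclic_resolutionD[OF A]
  \<comment> \<open>\<open>D m\<close> without its first column.\<close>
  define E where "E = mat (b m) p (\<lambda>(r, c). D m $$ (r, Suc c))"
  define D' where "D' = D(m := E, Suc m := 0\<^sub>m p 0, Suc (Suc m) := 0\<^sub>m 0 0)"
  let ?b = "b(Suc m := p, Suc (Suc m) := 0)" and ?s = "s(Suc m := \<lambda>c. s (Suc m) (Suc c))"
  obtain u where u: "D (Suc m) $$ (0, 0) * u = 1" using unit by (metis dvdE)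
  have E: "E *\<^sub>v w = D m *\<^sub>v vCons 0 w" if "w \<in> carrier_vec p" for w
    using that A(6)[of m] b(1)
    by (intro eq_vecI) (auto simp: E_def scalar_prod_def sum.atLeast0_lessThan_Suc_shift simp del: sum.op_ivl_Suc)
  have Dz: "D m *\<^sub>v (D (Suc m) *\<^sub>v t) = 0\<^sub>v (b m)" if "t \<in> carrier_vec 1" for t
    using mat_kernelD(2)[OF A(6), of _ m] exact_seqD(2)[OF A(3), of m] that b(2) by auto
  have top: "(D (Suc m) *\<^sub>v t) $ 0 = D (Suc m) $$ (0, 0) * t $ 0" "D (Suc m) *\<^sub>v t \<in> carrier_vec (Suc p)"
    if "t \<in> carrier_vec 1" for t
    using that A(6)[of "Suc m"] b by (auto simp: scalar_prod_def)
  have range: "(\<lambda>w. D m *\<^sub>v w) ` carrier_vec (Suc p) = (\<lambda>w. E *\<^sub>v w) ` carrier_vec p"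
  proof (intro subset_antisym subsetI)
    fix y assume "y \<in> (\<lambda>w. E *\<^sub>v w) ` carrier_vec p"
    then show "y \<in> (\<lambda>w. D m *\<^sub>v w) ` carrier_vec (Suc p)" using E by auto
  next
    fix y assume "y \<in> (\<lambda>w. D m *\<^sub>v w) ` carrier_vec (Suc p)"
    then obtain x where x: "x \<in> carrier_vec (Suc p)" "y = D m *\<^sub>v x" by blast
    \<comment> \<open>Changing \<open>x\<close> by the boundary of \<open>t\<close> clears its first coordinate.\<close>
    define t where "t = vec 1 (\<lambda>_. u * x $ 0)"
    have t: "t \<in> carrier_vec 1" by (simp add: t_def)
    define z where "z = D (Suc m) *\<^sub>v t"
    have z: "z \<in> carrier_vec (Suc p)" "z $ 0 = x $ 0"
      using top[OF t] u by (auto simp: z_def t_def mult.assoc[symmetric])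
    define w where "w = vec p (\<lambda>i. (x - z) $ Suc i)"
    have "x - z = vCons 0 w"
    proof (rule eq_vecI)
      fix i assume "i < dim_vec (vCons 0 w)"
      then show "(x - z) $ i = vCons 0 w $ i" using x(1) z by (cases i) (auto simp: w_def)
    qed (use x(1) z in \<open>simp add: w_def\<close>)
    then have "E *\<^sub>v w = D m *\<^sub>v (x - z)" using E[of w] by (simp add: w_def)
    also have "\<dots> = D m *\<^sub>v x - D m *\<^sub>v z"
      using mult_minus_distrib_mat_vec[OF A(6) , of x m z] x(1) z(1) b(1) by simp
    also have "\<dots> = y" using x A(6)[of m] b(1) unfolding z_def Dz[OF t] by (intro eq_vecI) auto
    finally show "y \<in> (\<lambda>w. E *\<^sub>v w) ` carrier_vec p" by (auto simp: w_def)
  qed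
  have Ec: "E \<in> carrier_mat (b m) p" by (simp add: E_def)
  have ker: "mat_kernel E = (\<lambda>w. 0\<^sub>m p 0 *\<^sub>v w) ` carrier_vec 0"
  proof -
    have "w = 0\<^sub>v p" if w: "w \<in> mat_kernel E" for w
    proof -
      from mat_kernelD[OF Ec w] have w: "w \<in> carrier_vec p" "E *\<^sub>v w = 0\<^sub>v (b m)" by auto
      have "vCons 0 w \<in> mat_kernel (D m)"
        using w b(1) E[OF w(1)] by (intro mat_kernelI[OF A(6)]) auto
      then obtain t where t: "t \<in> carrier_vec 1" "vCons 0 w = D (Suc m) *\<^sub>v t"
        unfolding exact_seqD(2)[OF A(3)] b(2) by auto
      have "D (Suc m) $$ (0, 0) * t $ 0 = 0" using top(1)[OF t(1)] t(2)[symmetric] by simp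
      then have "u * (D (Suc m) $$ (0, 0) * t $ 0) = 0" by simp
      then have "t $ 0 = 0" using u by (simp add: mult.assoc[symmetric] mult.commute[of u])
      then have "t = 0\<^sub>v 1" using t(1) by (auto intro!: eq_vecI)
      then have 0: "vCons 0 w = 0\<^sub>v (Suc p)"
        unfolding t(2) using A(6)[of "Suc m"] b by (intro eq_vecI) auto
      show ?thesis
      proof (rule eq_vecI)
        fix i assume "i < dim_vec (0\<^sub>v p :: ('a, 'b) mpoly vec)"
        then show "w $ i = 0\<^sub>v p $ i" using arg_cong[OF 0, of "\<lambda>v. v $ Suc i"] by simp
      qed (use w in simp)
    qed
    moreover have "E *\<^sub>v 0\<^sub>v p = 0\<^sub>v (b m)" using Ec by (intro eq_vecI) auto
    then have "0\<^sub>v p \<in> mat_kernel E" by (intro mat_kernelI[OF Ec]) auto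
    moreover have "0\<^sub>m p 0 *\<^sub>v 0\<^sub>v 0 = (0\<^sub>v p :: ('a, 'b) mpoly vec)" by (intro eq_vecI) (auto simp: scalar_prod_def)
    ultimately have "mat_kernel E = {0\<^sub>v p}" "0\<^sub>m p 0 *\<^sub>v 0\<^sub>v 0 = (0\<^sub>v p :: ('a, 'b) mpoly vec)" by blast+
    then show ?thesis unfolding carrier_vec_0 by simp
  qed
  have D': "D' i \<in> carrier_mat (?b i) (?b (Suc i))" for i
    using A(6)[of i] Ec b(3) by (auto simp: D'_def)
  have "exact_seq ?b D'"
    unfolding exact_seq_def
  proof (intro conjI allI D')
    fix i
    consider "i = m" | "i = Suc m" | "i = Suc (Suc m)" | "Suc i = m"
      | "i \<noteq> m" "i \<noteq> Suc m" "i \<noteq> Suc (Suc m)" "Suc i \<noteq> m" by blast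
    then show "mat_kernel (D' i) = (\<lambda>w. D' (Suc i) *\<^sub>v w) ` carrier_vec (?b (Suc (Suc i)))"
    proof cases
      case 1
      then show ?thesis using ker by (simp add: D'_def)
    next
      case 2
      then show ?thesis using trivial_kernel[OF D'[of "Suc m", simplified] D'[of "Suc (Suc m)", simplified]]
        by (simp add: b(3))
    next
      case 3
      have "D' (Suc (Suc (Suc m))) \<in> carrier_mat 0 (?b (Suc (Suc (Suc (Suc m)))))"
        using D'[of "Suc (Suc (Suc m))"] b(3) by simp
      moreover have "D' (Suc (Suc m)) \<in> carrier_mat 0 0" by (simp add: D'_def)
      ultimately show ?thesis unfolding 3 by (intro trivial_kernel)
    next
      case 4
      then have "mat_kernel (D' i) = mat_kernel (D i)" by (auto simp: D'_def)
      also have "\<dots> = (\<lambda>w. D m *\<^sub>v w) ` carrier_vec (Suc p)"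
        using exact_seqD(2)[OF A(3), of i] 4 b(1) by simp
      finally show ?thesis using 4 range by (auto simp: D'_def)
    next
      case 5
      then show ?thesis using exact_seqD(2)[OF A(3), of i] by (simp add: D'_def)
    qed
  qed
  moreover have "(\<lambda>w. D' 0 *\<^sub>v w) ` carrier_vec (?b 1) = (\<lambda>w. D 0 *\<^sub>v w) ` carrier_vec (b 1)"
    using range b(1) by (cases m) (auto simp: D'_def)
  moreover have "homogeneous (?s (Suc i) c - ?s i r) (D' i $$ (r, c))" if "r < ?b i" "c < ?b (Suc i)" for i r c
    using that A(5)[of r i c] A(5)[of r m "Suc c"] b(1) by (auto simp: D'_def E_def split: if_splits)
  ultimately have "cyclic_resolution I ?b ?s D'"
    unfolding cyclic_resolution_def using A(1,2,4) by simp
  moreover have "entries_in M (D' i)" for i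
    using entries[of i] entries[of m] A(6)[of m] b(1) by (auto simp: D'_def E_def entries_in_def)
  ultimately show ?thesis by (rule that)
qed

section \<open>Uniqueness of the ranks\<close>

text \<open>Otherwise, padding both matrices with zeros gives square matrices with product \<open>1\<close>, one of
which has a zero column.\<close>

lemma left_inverse_dim:
  fixes A :: "'k::field mat"
  assumes A: "A \<in> carrier_mat m n" and B: "B \<in> carrier_mat n m" and AB: "A * B = 1\<^sub>m m"
  shows "m \<le> n"
proof (rule ccontr)
  assume "\<not> m \<le> n"
  then have n: "n < m" by simp
  define A' where "A' = mat m m (\<lambda>(i, j). if j < n then A $$ (i, j) else 0)"
  define B' where "B' = mat m m (\<lambda>(i, j). if i < n then B $$ (i, j) else 0)"
  have c: "A' \<in> carrier_mat m m" "B' \<in> carrier_mat m m" by (simp_all add: A'_def B'_def)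
  have "A' * B' = A * B"
  proof (rule eq_matI)
    fix i j assume "i < dim_row (A * B)" "j < dim_col (A * B)"
    then have ij: "i < m" "j < m" using A B by auto
    have "(\<Sum>k = 0..<m. A' $$ (i, k) * B' $$ (k, j)) = (\<Sum>k = 0..<n. A $$ (i, k) * B $$ (k, j))"
      using n ij by (intro sum.mono_neutral_cong_right) (auto simp: A'_def B'_def)
    then show "(A' * B') $$ (i, j) = (A * B) $$ (i, j)"
      using ij c A B by (simp add: scalar_prod_def)
  qed (use A B c in auto)
  then have "det A' * det B' = 1" using det_mult[OF c] AB by simp
  moreover have "det A' = 0"
    using laplace_expansion_column[OF c(1), of "m - 1"] n by (simp add: A'_def)
  ultimately show False by simp
qed

text \<open>The first step of a comparison map between resolutions whose augmentations are arbitrary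
row vectors.\<close>

lemma augmentation_lift:
  fixes S :: "('v, 'k::field) mpoly set"
  assumes \<epsilon>: "\<epsilon> \<in> carrier_vec n" and \<epsilon>': "\<epsilon>' \<in> carrier_vec m"
    and surj: "\<And>a. \<exists>v\<in>carrier_vec m. a - \<epsilon>' \<bullet> v \<in> ideal_of S"
  obtains \<alpha> where "\<alpha> \<in> carrier_mat m n"
    "\<And>v. v \<in> carrier_vec n \<Longrightarrow> \<epsilon>' \<bullet> (\<alpha> *\<^sub>v v) - \<epsilon> \<bullet> v \<in> ideal_of S"
proof -
  obtain u where u: "\<And>a. u a \<in> carrier_vec m" "\<And>a. a - \<epsilon>' \<bullet> u a \<in> ideal_of S" using surj by metis
  define \<alpha> where "\<alpha> = mat m n (\<lambda>(r, c). u (\<epsilon> $ c) $ r)"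
  have \<alpha>: "\<alpha> \<in> carrier_mat m n" by (simp add: \<alpha>_def)
  show ?thesis
  proof (rule that[OF \<alpha>])
    fix v :: "('v, 'k) mpoly vec" assume v: "v \<in> carrier_vec n"
    have col: "col \<alpha> c = u (\<epsilon> $ c)" if "c < n" for c
      using u(1)[of "\<epsilon> $ c"] that by (intro eq_vecI) (auto simp: \<alpha>_def)
    have "\<epsilon>' \<bullet> (\<alpha> *\<^sub>v v) = (transpose_mat \<alpha> *\<^sub>v \<epsilon>') \<bullet> v"
      using transpose_vec_mult_scalar[OF \<alpha> v \<epsilon>'] by simp
    also have "\<dots> = (\<Sum>c = 0..<n. (\<epsilon>' \<bullet> u (\<epsilon> $ c)) * v $ c)"
      using \<alpha> v \<epsilon>' u(1) by (simp add: scalar_prod_def[of _ v] col comm_scalar_prod[of \<epsilon>' m])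
    finally have 1: "\<epsilon>' \<bullet> (\<alpha> *\<^sub>v v) = (\<Sum>c = 0..<n. (\<epsilon>' \<bullet> u (\<epsilon> $ c)) * v $ c)" .
    have 2: "\<epsilon> \<bullet> v = (\<Sum>c = 0..<n. \<epsilon> $ c * v $ c)" using v by (simp add: scalar_prod_def)
    have "\<epsilon>' \<bullet> (\<alpha> *\<^sub>v v) - \<epsilon> \<bullet> v = (\<Sum>c = 0..<n. - v $ c * (\<epsilon> $ c - \<epsilon>' \<bullet> u (\<epsilon> $ c)))"
      unfolding 1 2 sum_subtractf[symmetric] by (intro sum.cong refl) (simp add: algebra_simps)
    also have "\<dots> \<in> ideal_of S" by (intro ideal_sum ideal_mult u(2))
    finally show "\<epsilon>' \<bullet> (\<alpha> *\<^sub>v v) - \<epsilon> \<bullet> v \<in> ideal_of S" .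
  qed
qed

lemma minimal_graded_free_resolutionD:
  assumes "minimal_graded_free_resolution J b s \<epsilon> D"
  shows "\<epsilon> \<in> carrier_vec (b 0)" "exact_seq b D" "\<And>a. \<exists>v\<in>carrier_vec (b 0). a - \<epsilon> \<bullet> v \<in> J"
    "v \<in> carrier_vec (b 0) \<Longrightarrow> \<epsilon> \<bullet> v \<in> J \<longleftrightarrow> v \<in> (\<lambda>w. D 0 *\<^sub>v w) ` carrier_vec (b 1)"
    "entries_in irrelevant_ideal (D i)"
proof -
  have R: "graded_free_resolution J b s \<epsilon> D"
    and M: "\<And>i w r. w \<in> carrier_vec (b (Suc i)) \<Longrightarrow> r < b i \<Longrightarrow> (D i *\<^sub>v w) $ r \<in> irrelevant_ideal"
    using assms by (auto simp: minimal_graded_free_resolution_def)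
  note R' = R[unfolded graded_free_resolution_def]
  show "\<epsilon> \<in> carrier_vec (b 0)" using R' by (elim conjE)
  show "exact_seq b D" unfolding exact_seq_def using R' by (elim conjE) (intro conjI)
  show "\<exists>v\<in>carrier_vec (b 0). a - \<epsilon> \<bullet> v \<in> J" for a using R' by (elim conjE) (rule spec)
  have "{v \<in> carrier_vec (b 0). \<epsilon> \<bullet> v \<in> J} = (\<lambda>w. D 0 *\<^sub>v w) ` carrier_vec (b 1)"
    using R' by (elim conjE)
  from eqset_imp_iff[OF this, of v]
  show "\<epsilon> \<bullet> v \<in> J \<longleftrightarrow> v \<in> (\<lambda>w. D 0 *\<^sub>v w) ` carrier_vec (b 1)" if "v \<in> carrier_vec (b 0)"
    using that by simp
  have D: "D i \<in> carrier_mat (b i) (b (Suc i))" using R by (auto simp: graded_free_resolution_def)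
  have "D i $$ (r, c) \<in> irrelevant_ideal" if "r < b i" "c < b (Suc i)" for r c
    using M[of "unit_vec (b (Suc i)) c" i r] D that by simp
  then show "entries_in irrelevant_ideal (D i)" using D by (auto simp: entries_in_def)
qed

text \<open>Comparison maps \<open>\<alpha>\<close> and \<open>\<beta>\<close> in both directions compose to a map homotopic to the identity.
By minimality the difference \<open>\<beta> \<alpha> - 1\<close> has entries without constant term, and so the
constant terms of \<open>\<beta> i\<close> and \<open>\<alpha> i\<close> are matrices over the field with product \<open>1\<close>. The grading
plays no role in this argument.\<close>

lemma minimal_rank_le:
  fixes S :: "('v, 'k::field) mpoly set"
  assumes F: "minimal_graded_free_resolution (ideal_of S) b s \<epsilon> D"
    and G: "minimal_graded_free_resolution (ideal_of S) b' s' \<epsilon>' D'"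
  shows "b i \<le> b' i"
proof -
  have comparison: "\<exists>\<alpha>. (\<forall>i. \<alpha> i \<in> carrier_mat (c' i) (c i)) \<and> (\<forall>i. \<alpha> i * E i = E' i * \<alpha> (Suc i)) \<and>
      (\<forall>v\<in>carrier_vec (c 0). \<eta>' \<bullet> (\<alpha> 0 *\<^sub>v v) - \<eta> \<bullet> v \<in> ideal_of S)"
    if "minimal_graded_free_resolution (ideal_of S) c t \<eta> E"
      "minimal_graded_free_resolution (ideal_of S) c' t' \<eta>' E'"
    for c t \<eta> E c' t' \<eta>' E'
  proof -
    note F = minimal_graded_free_resolutionD[OF that(1)] and G = minimal_graded_free_resolutionD[OF that(2)]
    obtain \<alpha>0 where \<alpha>0: "\<alpha>0 \<in> carrier_mat (c' 0) (c 0)"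
      "\<And>v. v \<in> carrier_vec (c 0) \<Longrightarrow> \<eta>' \<bullet> (\<alpha>0 *\<^sub>v v) - \<eta> \<bullet> v \<in> ideal_of S"
      using augmentation_lift[OF F(1) G(1) G(3)] by blast
    note E = exact_seqD(1)[OF F(2)]
    have "col (\<alpha>0 * E 0) k \<in> (\<lambda>w. E' 0 *\<^sub>v w) ` carrier_vec (c' 1)" if k: "k < c 1" for k
    proof -
      have v: "col (E 0) k \<in> carrier_vec (c 0)" using k E[of 0] by (intro carrier_vecI) simp
      have "col (E 0) k = E 0 *\<^sub>v unit_vec (c 1) k" using k E[of 0] by (intro eq_vecI) auto
      then have "\<eta> \<bullet> col (E 0) k \<in> ideal_of S" using F(4)[OF v] by auto
      then have "\<eta>' \<bullet> (\<alpha>0 *\<^sub>v col (E 0) k) \<in> ideal_of S"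
        using ideal_add_iff[OF \<alpha>0(2)[OF v]] by simp
      then have "\<alpha>0 *\<^sub>v col (E 0) k \<in> (\<lambda>w. E' 0 *\<^sub>v w) ` carrier_vec (c' 1)"
        using G(4)[OF mult_mat_vec_carrier[OF \<alpha>0(1) v]] by simp
      then show ?thesis using col_mult2[OF \<alpha>0(1) E[of 0]] k by simp
    qed
    then show ?thesis
      using chain_map_extension[of E c c' E' \<alpha>0, OF E exact_comp_zero[OF F(2)] G(2) \<alpha>0(1)] \<alpha>0(2) by metis
  qed
  note F' = minimal_graded_free_resolutionD[OF F]
  note D = exact_seqD(1)[OF F'(2)]
  obtain \<alpha> where \<alpha>: "\<And>i. \<alpha> i \<in> carrier_mat (b' i) (b i)" "\<And>i. \<alpha> i * D i = D' i * \<alpha> (Suc i)"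
    "\<And>v. v \<in> carrier_vec (b 0) \<Longrightarrow> \<epsilon>' \<bullet> (\<alpha> 0 *\<^sub>v v) - \<epsilon> \<bullet> v \<in> ideal_of S"
    using comparison[OF F G] by blast
  obtain \<beta> where \<beta>: "\<And>i. \<beta> i \<in> carrier_mat (b i) (b' i)" "\<And>i. \<beta> i * D' i = D i * \<beta> (Suc i)"
    "\<And>v. v \<in> carrier_vec (b' 0) \<Longrightarrow> \<epsilon> \<bullet> (\<beta> 0 *\<^sub>v v) - \<epsilon>' \<bullet> v \<in> ideal_of S"
    using comparison[OF G F] by blast
  note D' = exact_seqD(1)[OF minimal_graded_free_resolutionD(2)[OF G]]
  have \<beta>\<alpha>: "\<beta> i * \<alpha> i \<in> carrier_mat (b i) (b i)" for i by (rule mult_carrier_mat[OF \<beta>(1) \<alpha>(1)])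
  define \<delta> where "\<delta> i = \<beta> i * \<alpha> i - 1\<^sub>m (b i)" for i
  have \<delta>: "\<delta> i \<in> carrier_mat (b i) (b i)" for i unfolding \<delta>_def by (rule minus_carrier_mat) simp
  have chain: "\<delta> i * D i = D i * \<delta> (Suc i)" for i
  proof -
    have "\<beta> i * \<alpha> i * D i = D i * (\<beta> (Suc i) * \<alpha> (Suc i))"
      unfolding assoc_mult_mat[OF \<beta>(1) \<alpha>(1) D] \<alpha>(2)
      unfolding assoc_mult_mat[OF \<beta>(1) D' \<alpha>(1), symmetric] \<beta>(2)
      by (rule assoc_mult_mat[OF D \<beta>(1) \<alpha>(1)])
    then show ?thesis
      unfolding \<delta>_def minus_mult_distrib_mat[OF \<beta>\<alpha> one_carrier_mat D]
        mult_minus_distrib_mat[OF D \<beta>\<alpha> one_carrier_mat] using D[of i] by simp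
  qed
  have "entries_in (ideal_of (indet ` UNIV)) (\<delta> i)"
  proof (rule endomorphism_entries[of b D, OF F'(2) _ \<delta> chain])
    show "entries_in (ideal_of (indet ` UNIV)) (D i)" for i using F'(5) by (simp add: irrelevant_ideal_def)
    fix c assume c: "c < b 0"
    let ?e = "unit_vec (b 0) c :: ('v, 'k) mpoly vec"
    have e: "?e \<in> carrier_vec (b 0)" by simp
    note \<alpha>e = mult_mat_vec_carrier[OF \<alpha>(1) e] and \<beta>\<alpha>e = mult_mat_vec_carrier[OF \<beta>(1) mult_mat_vec_carrier[OF \<alpha>(1) e]]
    have col: "col (\<delta> 0) c = \<beta> 0 *\<^sub>v (\<alpha> 0 *\<^sub>v ?e) - ?e"
      unfolding assoc_mult_mat_vec[OF \<beta>(1) \<alpha>(1) e, symmetric] mult_mat_unit_vec[OF \<beta>\<alpha> c]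
      using c \<alpha>(1)[of 0] \<beta>(1)[of 0] by (intro eq_vecI) (auto simp: \<delta>_def)
    have "\<epsilon> \<bullet> col (\<delta> 0) c = (\<epsilon> \<bullet> (\<beta> 0 *\<^sub>v (\<alpha> 0 *\<^sub>v ?e)) - \<epsilon>' \<bullet> (\<alpha> 0 *\<^sub>v ?e)) + (\<epsilon>' \<bullet> (\<alpha> 0 *\<^sub>v ?e) - \<epsilon> \<bullet> ?e)"
      unfolding col scalar_prod_minus_distrib[OF F'(1) \<beta>\<alpha>e e] by simp
    also have "\<dots> \<in> ideal_of S" by (intro ideal_add \<alpha>(3) \<beta>(3) \<alpha>e e)
    finally show "col (\<delta> 0) c \<in> (\<lambda>w. D 0 *\<^sub>v w) ` carrier_vec (b 1)"
      using F'(4)[of "col (\<delta> 0) c"] \<delta>[of 0] c by simp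
  qed
  then have irr: "const_coeff (\<delta> i $$ (r, c)) = 0" if "r < b i" "c < b i" for r c
    using \<delta>[of i] that unfolding irrelevant_ideal_def[symmetric] entries_in_def irrelevant_ideal_iff by auto
  let ?A = "map_mat const_coeff (\<alpha> i)" and ?B = "map_mat const_coeff (\<beta> i)"
  have AB: "?B \<in> carrier_mat (b i) (b' i)" "?A \<in> carrier_mat (b' i) (b i)" using \<alpha>(1) \<beta>(1) by auto
  have "?B * ?A = 1\<^sub>m (b i)"
  proof (rule eq_matI)
    fix r c assume "r < dim_row (1\<^sub>m (b i) :: 'k mat)" "c < dim_col (1\<^sub>m (b i) :: 'k mat)"
    then have rc: "r < b i" "c < b i" by auto
    have "(\<beta> i * \<alpha> i) $$ (r, c) = \<delta> i $$ (r, c) + 1\<^sub>m (b i) $$ (r, c)"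
      using rc \<beta>\<alpha>[of i] by (simp add: \<delta>_def)
    then have "const_coeff ((\<beta> i * \<alpha> i) $$ (r, c)) = 1\<^sub>m (b i) $$ (r, c)"
      using irr[OF rc] rc by simp
    then show "(?B * ?A) $$ (r, c) = 1\<^sub>m (b i) $$ (r, c)"
      using rc \<alpha>(1)[of i] \<beta>(1)[of i] by (simp add: scalar_prod_def const_coeff_sum)
  qed (use AB in auto)
  then show ?thesis by (rule left_inverse_dim[OF AB])
qed

lemma total_betti_eq:
  assumes "minimal_graded_free_resolution (ideal_of S) b s \<epsilon> D"
  shows "total_betti (ideal_of S) i = b i"
  unfolding total_betti_def
proof (rule the_equality)
  show "\<exists>b' s \<epsilon> D. minimal_graded_free_resolution (ideal_of S) b' s \<epsilon> D \<and> b i = b' i" using assms by blast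
  show "r = b i" if "\<exists>b s \<epsilon> D. minimal_graded_free_resolution (ideal_of S) b s \<epsilon> D \<and> r = b i" for r
    using that minimal_rank_le[OF assms] minimal_rank_le[OF _ assms] by (metis le_antisym)
qed

lemma cyclic_resolution_minimal:
  assumes R: "cyclic_resolution (ideal_of S) b s D" and M: "\<And>i. entries_in irrelevant_ideal (D i)"
  shows "minimal_graded_free_resolution (ideal_of S) b s (vec 1 (\<lambda>_. 1)) D"
proof -
  note R = cyclic_resolutionD[OF R]
  have prod: "vec 1 (\<lambda>_. 1) \<bullet> v = v $ 0" if "v \<in> carrier_vec 1" for v :: "('a, 'b) mpoly vec"
    using that by (simp add: scalar_prod_def)
  have "\<exists>v\<in>carrier_vec 1. a - vec 1 (\<lambda>_. 1) \<bullet> v \<in> ideal_of S" for a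
    using prod[of "vec 1 (\<lambda>_. a)"] by (intro bexI[of _ "vec 1 (\<lambda>_. a)"]) (simp_all add: ideal_zero)
  moreover have "{v \<in> carrier_vec 1. vec 1 (\<lambda>_. 1) \<bullet> v \<in> ideal_of S} = (\<lambda>w. D 0 *\<^sub>v w) ` carrier_vec (b 1)"
    using R(4) prod R(1) mult_mat_vec_carrier[OF R(6)[of 0]] by fastforce
  moreover have "(D i *\<^sub>v w) $ r \<in> irrelevant_ideal" if "w \<in> carrier_vec (b (Suc i))" "r < b i" for i w r
    using M[of i] R(6)[of i] that unfolding irrelevant_ideal_def entries_in_def
    by (auto simp: scalar_prod_def intro!: ideal_sum ideal_mult_right)
  ultimately show ?thesis
    unfolding minimal_graded_free_resolution_def graded_free_resolution_def
    using R(1,2,5) exact_seqD[OF R(3)] by (simp add: homogeneous_1)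
qed

section \<open>The two cones for a generic matrix times a generic column\<close>

lemma indet_irrelevant: "p \<in> ideal_of (set (Y_indets cs)) \<Longrightarrow> p \<in> irrelevant_ideal"
  unfolding irrelevant_ideal_def by (rule subsetD[OF ideal_mono]) auto

lemma rows_det_not_in_indets:
  assumes "distinct cs" "distinct rs" "length rs = length cs"
  shows "(rows_det rs cs :: (('m, 'n) var, 'k::field) mpoly) \<notin> ideal_of (set (Y_indets cs))"
proof
  assume "(rows_det rs cs :: (('m, 'n) var, 'k) mpoly) \<in> ideal_of (set (Y_indets cs))"
  then have "(1 :: (('m, 'n) var, 'k) mpoly) \<in> ideal_of (set (Y_indets cs))"
    using colon_minor[OF assms, of 1 cs] by simp
  then show False using indet_irrelevant[of 1 cs] by (simp add: irrelevant_ideal_iff)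
qed

lemma row_forms_resolution:
  fixes cs :: "'n list" and rs :: "'m list"
  assumes "distinct cs" "distinct rs" "length rs = length cs"
  shows "\<exists>s (D :: nat \<Rightarrow> (('m, 'n) var, 'k::field) mpoly mat).
    cyclic_resolution (ideal_of (row_form cs ` set rs)) (\<lambda>i. length cs choose i) s D \<and>
    (\<forall>i. \<forall>c<length cs choose i. s i c = int i * 2) \<and>
    (\<forall>i. entries_in (ideal_of (set (Y_indets cs))) (D i))"
proof -
  let ?gs = "map (row_form cs) rs :: (('m, 'n) var, 'k) mpoly list"
  have "regular ?gs" using regular_row_forms[of cs rs] assms by simp
  moreover have "homogeneous 2 f" "f \<in> ideal_of (set (Y_indets cs))" if "f \<in> set ?gs" for f
    using that homogeneous_row_form row_form_in_indets by auto
  ultimately show ?thesis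
    using koszul_resolution[of ?gs 2 "set (Y_indets cs)"] assms(3) by (simp del: ball_simps all_simps)
qed

lemma indets_resolution:
  fixes cs :: "'n list"
  assumes "distinct cs"
  shows "\<exists>s (D :: nat \<Rightarrow> (('m, 'n) var, 'k::field) mpoly mat).
    cyclic_resolution (ideal_of (set (Y_indets cs))) (\<lambda>i. length cs choose i) s D \<and>
    (\<forall>i. \<forall>c<length cs choose i. s i c = int i) \<and>
    (\<forall>i. entries_in (ideal_of (set (Y_indets cs))) (D i))"
proof -
  let ?ys = "Y_indets cs :: (('m, 'n) var, 'k) mpoly list"
  have "homogeneous 1 f" "f \<in> ideal_of (set ?ys)" if "f \<in> set ?ys" for f
    using that homogeneous_indet by (auto intro: ideal_base)
  then show ?thesis
    using koszul_resolution[OF regular_indets[OF assms], of 1 "set ?ys"] by (simp del: ball_simps all_simps)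
qed

text \<open>Let \<open>g\<close> be the \<open>n\<close> forms and \<open>\<Delta>\<close> the determinant. As \<open>(g) : \<Delta> = (y)\<close>, the ideal \<open>(g) + (\<Delta>)\<close>
is resolved by the cone of a map from the Koszul complex of \<open>y\<close> to that of \<open>g\<close>. In
homological degree \<open>i\<close> the generators of the two have degrees \<open>i + n\<close> and \<open>2 i\<close>, so that the
map is minimal except for \<open>i = n\<close>, where it is a constant. This constant is not zero:
otherwise the composite with a map back from \<open>g\<close> to \<open>y\<close>, which lifts \<open>\<Delta>\<close> on the complex of
\<open>g\<close>, would be zero in degree \<open>n\<close>, but it differs from \<open>\<Delta>\<close> by an element of \<open>(y)\<close>, and \<open>\<Delta>\<close> is
not in \<open>(y)\<close>. So it can be cancelled, which leaves rank \<open>n\<close> in degree \<open>n\<close>. The bound on the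
degrees of the generators yields minimality of the next cone.\<close>

lemma minor_ideal_resolution:
  fixes cs :: "'n list" and rs :: "'m list"
  assumes cs: "distinct cs" and rs: "distinct rs" and len: "length rs = length cs" and n: "length cs = Suc m"
  defines "b \<equiv> (\<lambda>i. Suc (Suc m) choose i)(Suc m := Suc m, Suc (Suc m) := 0)"
  obtains s and D :: "nat \<Rightarrow> (('m, 'n) var, 'k::field) mpoly mat"
  where "cyclic_resolution (ideal_of (insert (rows_det rs cs) (row_form cs ` set rs))) b s D"
    and "\<And>i. entries_in irrelevant_ideal (D i)"
    and "\<And>i c. c < b i \<Longrightarrow> 2 * int i - 1 \<le> s i c"
proof -
  let ?\<Delta> = "rows_det rs cs :: (('m, 'n) var, 'k) mpoly" and ?n = "Suc m"
  let ?I = "row_form cs ` set rs :: (('m, 'n) var, 'k) mpoly set"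
    and ?Y = "set (Y_indets cs) :: (('m, 'n) var, 'k) mpoly set"
  let ?c = "\<lambda>i. Suc m choose i"
  obtain s D where A: "cyclic_resolution (ideal_of ?I) ?c s D" and s: "\<And>i c. c < ?c i \<Longrightarrow> s i c = int i * 2"
    and M: "\<And>i. entries_in (ideal_of ?Y) (D i)"
    using row_forms_resolution[OF cs rs len] unfolding n by blast
  obtain s' D' where B: "cyclic_resolution (ideal_of ?Y) ?c s' D'" and s': "\<And>i c. c < ?c i \<Longrightarrow> s' i c = int i"
    and M': "\<And>i. entries_in (ideal_of ?Y) (D' i)"
    using indets_resolution[OF cs] unfolding n by blast
  have Y: "p \<in> irrelevant_ideal" if "p \<in> ideal_of ?Y" for p using indet_irrelevant[OF that] .
  note DA = cyclic_resolutionD[OF A] and DB = cyclic_resolutionD[OF B]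
  have hom\<Delta>: "homogeneous (int ?n) ?\<Delta>" using homogeneous_rows_det[OF len] n by simp
  have not_Y: "?\<Delta> \<notin> ideal_of ?Y" by (rule rows_det_not_in_indets[OF cs rs len])
  have I_Y: "p \<in> ideal_of ?Y" if "p \<in> ideal_of ?I" for p
    by (rule ideal_subset[OF _ that]) (use row_form_in_indets in auto)
  have Q: "p \<in> ideal_of ?Y \<longleftrightarrow> ?\<Delta> * p \<in> ideal_of ?I" for p
    using minor_mult_indet[OF len, of p] colon_minor[OF cs rs len, of p cs] I_Y[of "?\<Delta> * p"]
    by (auto simp: mult.commute)
  obtain \<alpha> where \<alpha>: "\<And>i. \<alpha> i \<in> carrier_mat (?c i) (?c i)" "\<alpha> 0 $$ (0, 0) = ?\<Delta>"
    "\<And>i. \<alpha> i * D' i = D i * \<alpha> (Suc i)"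
    "\<And>i r c. r < ?c i \<Longrightarrow> c < ?c i \<Longrightarrow> homogeneous (s' i c + int ?n - s i r) (\<alpha> i $$ (r, c))"
    using graded_comparison[OF A B hom\<Delta>] Q by metis
  obtain \<beta> where \<beta>: "\<And>i. \<beta> i \<in> carrier_mat (?c i) (?c i)" "\<beta> 0 $$ (0, 0) = 1"
    "\<And>i. \<beta> i * D i = D' i * \<beta> (Suc i)"
    using graded_comparison[OF B A homogeneous_1] I_Y by (metis mult_1)
  have unit: "\<alpha> ?n $$ (0, 0) dvd 1"
  proof (rule homogeneous_0_dvd_1)
    show "homogeneous 0 (\<alpha> ?n $$ (0, 0))" using \<alpha>(4)[of 0 ?n 0] s[of 0 ?n] s'[of 0 ?n] by simp
    show "\<alpha> ?n $$ (0, 0) \<noteq> 0"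
    proof
      assume zero: "\<alpha> ?n $$ (0, 0) = 0"
      define \<delta> where "\<delta> i = \<alpha> i * \<beta> i - ?\<Delta> \<cdot>\<^sub>m 1\<^sub>m (?c i)" for i
      have \<alpha>\<beta>: "\<alpha> i * \<beta> i \<in> carrier_mat (?c i) (?c i)" for i by (rule mult_carrier_mat[OF \<alpha>(1) \<beta>(1)])
      have one: "?\<Delta> \<cdot>\<^sub>m 1\<^sub>m k \<in> carrier_mat k k" for k by simp
      have \<delta>: "\<delta> i \<in> carrier_mat (?c i) (?c i)" for i unfolding \<delta>_def by (rule minus_carrier_mat) simp
      have chain: "\<delta> i * D i = D i * \<delta> (Suc i)" for i
      proof -
        have "\<alpha> i * \<beta> i * D i = D i * (\<alpha> (Suc i) * \<beta> (Suc i))"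
          unfolding assoc_mult_mat[OF \<alpha>(1) \<beta>(1) DA(6)] \<beta>(3)
          unfolding assoc_mult_mat[OF \<alpha>(1) DB(6) \<beta>(1), symmetric] \<alpha>(3)
          by (rule assoc_mult_mat[OF DA(6) \<alpha>(1) \<beta>(1)])
        then show ?thesis
          unfolding \<delta>_def minus_mult_distrib_mat[OF \<alpha>\<beta> one DA(6)] mult_minus_distrib_mat[OF DA(6) \<alpha>\<beta> one]
            mult_smult_assoc_mat[OF one_carrier_mat DA(6)] mult_smult_distrib[OF DA(6) one_carrier_mat]
          using DA(6)[of i] by simp
      qed
      have "\<delta> 0 = 0\<^sub>m 1 1"
        using \<alpha>(1)[of 0] \<beta>(1)[of 0] \<alpha>(2) \<beta>(2) by (intro eq_matI) (auto simp: \<delta>_def scalar_prod_def)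
      then have "col (\<delta> 0) c \<in> (\<lambda>w. D 0 *\<^sub>v w) ` carrier_vec (?c 1)" if "c < ?c 0" for c
        using that DA(6)[of 0] by (intro image_eqI[of _ _ "0\<^sub>v (?c 1)"]) (auto intro!: eq_vecI simp: scalar_prod_def)
      then have "entries_in (ideal_of ?Y) (\<delta> ?n)"
        by (intro endomorphism_entries[of ?c D, OF DA(3) M \<delta> chain])
      then have "\<delta> ?n $$ (0, 0) \<in> ideal_of ?Y" using \<delta>[of ?n] by (auto simp: entries_in_def)
      moreover have "\<delta> ?n $$ (0, 0) = - ?\<Delta>"
        using \<alpha>(1)[of ?n] \<beta>(1)[of ?n] zero by (simp add: \<delta>_def scalar_prod_def)
      ultimately show False
        using ideal_uminus[of "- ?\<Delta>" ?Y] not_Y by simp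
    qed
  qed
  note idx = cone_diff_index[of D _ ?c D' ?c \<alpha>, OF DA(6) DB(6) \<alpha>(1), unfolded cone_rank_choose]
  have cone: "cyclic_resolution (ideal_of (insert ?\<Delta> ?I)) (\<lambda>i. Suc (Suc m) choose i)
      (cone_shift ?c s s' (int ?n)) (cone_diff D D' \<alpha>)"
    using cone_resolution[OF A B Q \<alpha>] by (simp only: cone_rank_choose)
  have irr: "entries_in irrelevant_ideal (cone_diff D D' \<alpha> i)" if "i \<noteq> ?n" for i
    unfolding irrelevant_ideal_def
  proof (rule cone_entries[of D ?c D' ?c \<alpha>, OF DA(6) DB(6) \<alpha>(1)])
    show "entries_in (ideal_of (indet ` UNIV)) (D i)" "entries_in (ideal_of (indet ` UNIV)) (D' j)" for j
      using M[of i] M'[of j] Y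
      unfolding irrelevant_ideal_def[symmetric] by (auto simp: entries_in_def)
    have "\<alpha> i $$ (r, c) \<in> irrelevant_ideal" if "r < ?c i" "c < ?c i" for r c
      unfolding irrelevant_ideal_iff using \<open>i \<noteq> ?n\<close> s[OF that(1)] s'[OF that(2)]
      by (intro homogeneous_const_coeff[OF \<alpha>(4)[OF that]]) simp
    then show "entries_in (ideal_of (indet ` UNIV)) (\<alpha> i)"
      using \<alpha>(1)[of i] by (auto simp: irrelevant_ideal_def entries_in_def)
  qed
  have corner: "cone_diff D D' \<alpha> ?n $$ (0, 0) = \<alpha> ?n $$ (0, 0)"
    by (subst idx(2)) (simp_all add: binomial_eq_0)
  obtain E where E: "cyclic_resolution (ideal_of (insert ?\<Delta> ?I)) b
      ((cone_shift ?c s s' (int ?n))(Suc m := \<lambda>c. cone_shift ?c s s' (int ?n) (Suc m) (Suc c))) E"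
    and "\<And>i. entries_in irrelevant_ideal (E i)"
    using cancel_unit[OF cone, of m "Suc m" irrelevant_ideal] irr corner unit
    unfolding b_def by (auto simp: binomial_eq_0)
  then show ?thesis
  proof (rule that)
    fix i c assume c: "c < b i"
    let ?s = "cone_shift ?c s s' (int ?n)"
    have bound: "2 * int i - 1 \<le> ?s i c'" if c': "c' < Suc (Suc m) choose i" and i: "i \<le> ?n" for c'
    proof (cases "c' < ?c i")
      case True
      then show ?thesis by (simp add: cone_shift_def s)
    next
      case False
      have "c' < cone_rank ?c ?c i" using c' by (simp only: cone_rank_choose)
      then obtain j where j: "i = Suc j" "c' - ?c i < ?c j"
        by (rule cone_rank_cases) (use False in blast)+
      then show ?thesis using False i by (simp add: cone_shift_def s')
    qed
    have i: "i \<le> ?n"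
    proof (rule ccontr)
      assume "\<not> i \<le> ?n"
      then have "b i = 0" by (cases "i = Suc (Suc m)") (auto simp: b_def binomial_eq_0)
      then show False using c by simp
    qed
    show "2 * int i - 1 \<le> (?s(Suc m := \<lambda>c. ?s (Suc m) (Suc c))) i c"
    proof (cases "i = Suc m")
      case True
      then show ?thesis using bound[of "Suc c"] c by (simp add: b_def)
    next
      case False
      then show ?thesis using bound[of c] c i by (simp add: b_def)
    qed
  qed
qed

text \<open>Since \<open>(g) : g r = (g) + (\<Delta>)\<close> for the form \<open>g r\<close> of the remaining row, the cone of a lift
of multiplication by \<open>g r\<close> is a resolution. It is minimal: after the shift by \<open>2\<close>,
generators in homological degree \<open>i\<close> of the source have degree at least \<open>2 i + 1\<close>, those of
the target have degree \<open>2 i\<close>, and no constant can occur.\<close>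

theorem betti_row_forms:
  fixes cs :: "'n list" and rs :: "'m list"
  assumes cs: "distinct cs" and rs: "distinct (r # rs)" and len: "length rs = length cs" and n: "length cs = Suc m"
  shows "total_betti (ideal_of (row_form cs ` set (r # rs)) :: (('m, 'n) var, 'k::field) mpoly set) i =
    cone_rank (\<lambda>i. Suc m choose i) ((\<lambda>i. Suc (Suc m) choose i)(Suc m := Suc m, Suc (Suc m) := 0)) i"
proof -
  let ?f = "row_form cs r :: (('m, 'n) var, 'k) mpoly"
  let ?I = "row_form cs ` set rs :: (('m, 'n) var, 'k) mpoly set"
  let ?Q = "insert (rows_det rs cs) ?I" and ?Y = "set (Y_indets cs) :: (('m, 'n) var, 'k) mpoly set"
  let ?c = "\<lambda>i. Suc m choose i" and ?b = "(\<lambda>i. Suc (Suc m) choose i)(Suc m := Suc m, Suc (Suc m) := 0)"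
  have rs': "distinct rs" using rs by simp
  obtain s D where A: "cyclic_resolution (ideal_of ?I) ?c s D" and s: "\<And>i c. c < ?c i \<Longrightarrow> s i c = int i * 2"
    and M: "\<And>i. entries_in (ideal_of ?Y) (D i)"
    using row_forms_resolution[OF cs rs' len] unfolding n by blast
  obtain s' D' where B: "cyclic_resolution (ideal_of ?Q) ?b s' D'"
    and M': "\<And>i. entries_in irrelevant_ideal (D' i)"
    and s': "\<And>i c. c < ?b i \<Longrightarrow> 2 * int i - 1 \<le> s' i c"
    using minor_ideal_resolution[OF cs rs' len n] by blast
  have Y: "p \<in> irrelevant_ideal" if "p \<in> ideal_of ?Y" for p using indet_irrelevant[OF that] .
  note DA = cyclic_resolutionD[OF A] and DB = cyclic_resolutionD[OF B]
  have Q: "p \<in> ideal_of ?Q \<longleftrightarrow> ?f * p \<in> ideal_of ?I" for p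
  proof
    assume "p \<in> ideal_of ?Q"
    then obtain k where "p - k * rows_det rs cs \<in> ideal_of ?I" unfolding ideal_insert_iff ..
    from ideal_add[OF ideal_mult[OF this, of ?f] ideal_mult[OF minor_mult_row_form[OF len], of k r]]
    show "?f * p \<in> ideal_of ?I" by (simp add: algebra_simps)
  next
    assume "?f * p \<in> ideal_of ?I"
    then show "p \<in> ideal_of ?Q" using colon_row_form[OF cs rs len, of p] by (simp add: mult.commute)
  qed
  obtain \<alpha> where \<alpha>: "\<And>i. \<alpha> i \<in> carrier_mat (?c i) (?b i)" "\<alpha> 0 $$ (0, 0) = ?f"
    "\<And>i. \<alpha> i * D' i = D i * \<alpha> (Suc i)"
    "\<And>i r c. r < ?c i \<Longrightarrow> c < ?b i \<Longrightarrow> homogeneous (s' i c + 2 - s i r) (\<alpha> i $$ (r, c))"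
    using graded_comparison[OF A B homogeneous_row_form[of cs r]] Q by metis
  have "cyclic_resolution (ideal_of (insert ?f ?I)) (cone_rank ?c ?b) (cone_shift ?c s s' 2) (cone_diff D D' \<alpha>)"
    by (rule cone_resolution[OF A B Q \<alpha>])
  moreover have "entries_in irrelevant_ideal (cone_diff D D' \<alpha> i)" for i
    unfolding irrelevant_ideal_def
  proof (rule cone_entries[of D ?c D' ?b \<alpha>, OF DA(6) DB(6) \<alpha>(1)])
    show "entries_in (ideal_of (indet ` UNIV)) (D i)" "entries_in (ideal_of (indet ` UNIV)) (D' j)" for j
      using M[of i] M'[of j] Y
      unfolding irrelevant_ideal_def[symmetric] by (auto simp: entries_in_def)
    have "\<alpha> i $$ (r, c) \<in> irrelevant_ideal" if "r < ?c i" "c < ?b i" for r c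
      unfolding irrelevant_ideal_iff using s[OF that(1)] s'[OF that(2)]
      by (intro homogeneous_const_coeff[OF \<alpha>(4)[OF that]]) simp
    then show "entries_in (ideal_of (indet ` UNIV)) (\<alpha> i)"
      using \<alpha>(1)[of i] unfolding irrelevant_ideal_def entries_in_def by (metis carrier_matD)
  qed
  ultimately have "minimal_graded_free_resolution (ideal_of (insert ?f ?I)) (cone_rank ?c ?b)
      (cone_shift ?c s s' 2) (vec 1 (\<lambda>_. 1)) (cone_diff D D' \<alpha>)"
    by (rule cyclic_resolution_minimal)
  then show ?thesis using total_betti_eq by simp
qed

theorem theorem6p3:
  fixes n :: nat
    and J :: "(('m::finite, 'n::finite) var, 'k::field) mpoly set"
  assumes "n \<ge> 1"
    and "CARD('n) = n"
    and "CARD('m) = n + 1"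
    and "J = ideal_J"
  shows "total_betti J 0 = 1 \<and>
         total_betti J 1 = n + 1 \<and>
         total_betti J (n + 1) = n \<and>
         (\<forall>k. 1 \<le> k \<and> k < n \<longrightarrow>
            total_betti J (k + 1) = (n choose k) + (n choose (k - 1)) + (n choose (k + 1))) \<and>
         (\<forall>i>n + 1. total_betti J i = 0)"
proof -
  obtain m where m: "n = Suc m" using assms(1) by (cases n) auto
  obtain cs :: "'n list" where cs: "set cs = UNIV" "distinct cs"
    using finite_distinct_list[of "UNIV :: 'n set"] by auto
  obtain rs0 :: "'m list" where rs0: "set rs0 = UNIV" "distinct rs0"
    using finite_distinct_list[of "UNIV :: 'm set"] by auto
  have len: "length cs = n" "length rs0 = n + 1"
    using distinct_card[OF cs(2)] distinct_card[OF rs0(2)] cs(1) rs0(1) assms(2,3) by simp_all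
  then obtain r rs where rs: "rs0 = r # rs" by (cases rs0) auto
  have "g i = (row_form cs i :: (('m, 'n) var, 'k) mpoly)" for i
    by (simp add: g_def row_form_def sum_list_distinct_conv_sum_set cs)
  then have J: "J = ideal_of (row_form cs ` set (r # rs))"
    using assms(4) rs0(1) by (simp add: ideal_J_def rs)
  have betti: "total_betti J i = cone_rank (\<lambda>i. n choose i) ((\<lambda>i. Suc n choose i)(n := n, Suc n := 0)) i" for i
    unfolding J m by (rule betti_row_forms) (use cs(2) rs0(2) len rs m in simp_all)
  show ?thesis
    unfolding betti using assms(1)
    by (auto simp: cone_rank_def binomial_eq_0 choose_reduce_nat[of "Suc n"] split: nat.split)
qed

end
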